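(* Let $\tilde\theta$ be a probability distribution on $\mathbb{R}^d$ satisfying: there is a convex open set $\Theta\subseteq\mathbb{R}^d$, with $d\ge 5$, such that $\tilde\theta$ has a probability density function $p$ that is continuously differentiable on $\Theta$, $\mathbb{P}_{\theta\sim\tilde\theta}[\theta\in\Theta]=1$, and $\mathbb{E}_{\theta\sim\tilde\theta}\|\theta\|_2<\infty$. Let $\Sigma$ and $S$ be (symmetric) positive definite $d\times d$ real matrices. Then the $\Sigma$-skewed geometric median is asymptotically $\mathrm{Skew}(S^{-1}H^\Sigma_\infty S^{-1})$-strategyproof for a voter with $S$-skewed preferences: writing $\alpha=\mathrm{Skew}(S^{-1}H^\Sigma_\infty S^{-1})$, for all $\varepsilon,\delta>0$ there exists $V_0\ge1$ such that for all $V\ge V_0$, if $\theta_1,\dots,\theta_V$ are drawn independently from $\tilde\theta$ and $\vec\theta=(\theta_1,\dots,\theta_V)$, then with probability at least $1-\delta$, $$\forall t,s\in\mathbb{R}^d,\quad \|\mathrm{Gm}^\Sigma(t,\vec\theta)-t\|_S\le(1+\alpha+\varepsilon)\,\|\mathrm{Gm}^\Sigma(s,\vec\theta)-t\|_S .$$ In particular, if $H^\Sigma_\infty=S^2$, then the $\Sigma$-skewed geometric median is asymptotically strategyproof for this voter, i.e. for all $\varepsilon,\delta>0$ there exists $V_0\ge1$ such that for all $V\ge V_0$, if $\theta_1,\dots,\theta_V$ are drawn independently from $\tilde\theta$ and $\vec\theta=(\theta_1,\dots,\theta_V)$, then with probability at least $1-\delta$, $$\forall t,s\in\mathbb{R}^d,\quad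 \|\mathrm{Gm}^\Sigma(t,\vec\theta)-t\|_S\le(1+\varepsilon)\,\|\mathrm{Gm}^\Sigma(s,\vec\theta)-t\|_S .$$
   Context: For a positive definite matrix $M$, $\|x\|_M=\|Mx\|_2$. For $s\in\mathbb{R}^d$ and $\vec\theta=(\theta_1,\dots,\theta_V)\in(\mathbb{R}^d)^V$, the $\Sigma$-skewed geometric median $\mathrm{Gm}^\Sigma(s,\vec\theta)$ is a minimizer over $z\in\mathbb{R}^d$ of $\frac{1}{1+V}\big(\|z-s\|_\Sigma+\sum_{v=1}^V\|z-\theta_v\|_\Sigma\big)$. $\mathcal{L}^\Sigma_\infty(z)=\mathbb{E}_{\theta\sim\tilde\theta}\|z-\theta\|_\Sigma$, $g^\Sigma_\infty$ is the (unique) minimizer of $\mathcal{L}^\Sigma_\infty$ over $\mathbb{R}^d$, and $H^\Sigma_\infty=\nabla^2\mathcal{L}^\Sigma_\infty(g^\Sigma_\infty)$ is the Hessian matrix of the skewed loss there (well defined and positive definite under the stated assumption on $\tilde\theta$). For a (symmetric) positive definite matrix $A$, $\mathrm{Skew}(A)=\sup_{x\ne 0}\Big\{\frac{\|x\|_2\|Ax\|_2}{x^TAx}-1\Big\}$. A voter with $S$-skewed preference wants to minimize the $S$-Mahalanobis distance $\|\cdot\|_S$ between the outcome of the vote and their target vector $t$. *)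

theory Defs
  imports "HOL-Probability.Probability"
begin

definition pos_def_matrix :: "real^'d^'d \<Rightarrow> bool" where
  "pos_def_matrix A \<longleftrightarrow> transpose A = A \<and> (\<forall>x. x \<noteq> 0 \<longrightarrow> x \<bullet> (A *v x) > 0)"

text \<open>The norm uses the matrix itself, not its square root.\<close>

definition mnorm :: "real^'d^'d \<Rightarrow> real^'d \<Rightarrow> real" where
  "mnorm M x = norm (M *v x)"

text \<open>The supremum is taken in the reals; for positive definite \<open>A\<close> the set is nonempty and
  bounded above, so \<open>Sup\<close> is the genuine supremum.\<close>

definition Skew :: "real^'d^'d \<Rightarrow> real" where
  "Skew A = (SUP x\<in>{x. x \<noteq> 0}. norm x * norm (A *v x) / (x \<bullet> (A *v x)) - 1)"

definition grad :: "('a::real_inner \<Rightarrow> real) \<Rightarrow> 'a \<Rightarrow> 'a" where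
  "grad f x = (THE D. GDERIV f x :> D)"

definition hessian :: "(real^'d \<Rightarrow> real) \<Rightarrow> real^'d \<Rightarrow> real^'d^'d" where
  "hessian f x = jacobian (grad f) (at x)"

definition cont_differentiable_on :: "('a::real_inner \<Rightarrow> real) \<Rightarrow> 'a set \<Rightarrow> bool" where
  "cont_differentiable_on f A \<longleftrightarrow>
     (\<exists>f'. (\<forall>x\<in>A. GDERIV f x :> f' x) \<and> continuous_on A f')"

definition empirical_loss ::
    "real^'d^'d \<Rightarrow> real^'d \<Rightarrow> nat \<Rightarrow> (nat \<Rightarrow> real^'d) \<Rightarrow> real^'d \<Rightarrow> real" where
  "empirical_loss \<Sigma> s V \<theta> z =
     (1 / (1 + real V)) * (mnorm \<Sigma> (z - s) + (\<Sum>v=1..V. mnorm \<Sigma> (z - \<theta> v)))"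

text \<open>A minimizer need not be unique when all the points lie on one line, so the median is a
  relation: \<open>is_skewed_gm \<Sigma> s V \<theta> g\<close> says that \<open>g\<close> is a value of the median.\<close>

definition is_skewed_gm ::
    "real^'d^'d \<Rightarrow> real^'d \<Rightarrow> nat \<Rightarrow> (nat \<Rightarrow> real^'d) \<Rightarrow> real^'d \<Rightarrow> bool" where
  "is_skewed_gm \<Sigma> s V \<theta> g \<longleftrightarrow> is_arg_min (empirical_loss \<Sigma> s V \<theta>) (\<lambda>_. True) g"

definition limit_loss :: "real^'d^'d \<Rightarrow> (real^'d) measure \<Rightarrow> real^'d \<Rightarrow> real" where
  "limit_loss \<Sigma> D z = (LINT \<theta>|D. mnorm \<Sigma> (z - \<theta>))"

definition limit_gm :: "real^'d^'d \<Rightarrow> (real^'d) measure \<Rightarrow> real^'d" where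
  "limit_gm \<Sigma> D = arg_min (limit_loss \<Sigma> D) (\<lambda>_. True)"

definition limit_hessian :: "real^'d^'d \<Rightarrow> (real^'d) measure \<Rightarrow> real^'d^'d" where
  "limit_hessian \<Sigma> D = hessian (limit_loss \<Sigma> D) (limit_gm \<Sigma> D)"

text \<open>``With probability at least \<open>q\<close>'', for a property whose extension need not be
  measurable: it holds on some measurable event of probability at least \<open>q\<close>.\<close>

definition with_prob_at_least :: "'a measure \<Rightarrow> real \<Rightarrow> ('a \<Rightarrow> bool) \<Rightarrow> bool" where
  "with_prob_at_least M q P \<longleftrightarrow> (\<exists>A\<in>sets M. (\<forall>\<omega>\<in>A. P \<omega>) \<and> measure M A \<ge> q)"

text \<open>Strategyproofness of the \<open>\<Sigma>\<close>-skewed median for a voter with \<open>S\<close>-skewed preferences and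
  voters \<open>1, \<dots>, V\<close> drawn independently from \<open>D\<close>. The inequality is required for every value
  of the median. Plain asymptotic strategyproofness is the case \<open>\<alpha> = 0\<close>.\<close>

definition asymp_strategyproof ::
    "real \<Rightarrow> real^'d^'d \<Rightarrow> real^'d^'d \<Rightarrow> (real^'d) measure \<Rightarrow> bool" where
  "asymp_strategyproof \<alpha> \<Sigma> S D \<longleftrightarrow>
     (\<forall>\<epsilon>>0. \<forall>\<delta>>0. \<exists>V0\<ge>1. \<forall>V\<ge>V0.
        with_prob_at_least (Pi\<^sub>M {1..V} (\<lambda>_. D)) (1 - \<delta>)
          (\<lambda>\<theta>. \<forall>t s gt gs. is_skewed_gm \<Sigma> t V \<theta> gt \<longrightarrow> is_skewed_gm \<Sigma> s V \<theta> gs \<longrightarrow>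
             mnorm S (gt - t) \<le> (1 + \<alpha> + \<epsilon>) * mnorm S (gs - t)))"

text \<open>The median always has a value, so the requirement above is never vacuous.\<close>

lemma skewed_gm_exists:
  fixes \<Sigma> :: "real^'d^'d"
  assumes "pos_def_matrix \<Sigma>"
  shows "\<exists>g. is_skewed_gm \<Sigma> s V \<theta> g"
proof -
  let ?L = "\<lambda>z. mnorm \<Sigma> (z - s) + (\<Sum>v=1..V. mnorm \<Sigma> (z - \<theta> v))"
  have lin: "linear ((*v) \<Sigma>)" by simp
  have "inj ((*v) \<Sigma>)"
    unfolding linear_injective_0[OF lin] using assms
    by (metis inner_zero_right less_irrefl pos_def_matrix_def)
  then obtain c where c: "c > 0" "\<And>x. norm (\<Sigma> *v x) \<ge> c * norm x"
    using linear_inj_bounded_below_pos[OF lin] by (metis mult.commute)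
  define r where "r = ?L s / c"
  have L0: "?L z \<ge> 0" for z unfolding mnorm_def by (simp add: sum_nonneg)
  have r0: "r \<ge> 0" unfolding r_def using L0[of s] c(1) by simp
  have cont: "continuous_on (cball s r) ?L"
    unfolding mnorm_def
    by (intro continuous_intros linear_continuous_on_compose[OF _ lin])
  have "\<exists>g\<in>cball s r. \<forall>z\<in>cball s r. ?L g \<le> ?L z"
    by (rule continuous_attains_inf[OF compact_cball _ cont]) (use r0 in auto)
  then obtain g where g: "\<And>z. z \<in> cball s r \<Longrightarrow> ?L g \<le> ?L z" by blast
  have "?L g \<le> ?L z" for z
  proof (cases "z \<in> cball s r")
    case False
    then have "r < norm (z - s)" by (simp add: dist_norm norm_minus_commute)
    then have "?L s < c * norm (z - s)"
      using c(1) by (simp add: r_def divide_less_eq mult.commute)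
    also have "\<dots> \<le> mnorm \<Sigma> (z - s)" using c(2) by (simp add: mnorm_def)
    also have "\<dots> \<le> ?L z" by (simp add: mnorm_def sum_nonneg)
    finally have "?L s \<le> ?L z" by simp
    moreover have "?L g \<le> ?L s" using r0 by (intro g) simp
    ultimately show ?thesis by linarith
  qed (rule g)
  then have "is_skewed_gm \<Sigma> s V \<theta> g"
    unfolding is_skewed_gm_def is_arg_min_linorder empirical_loss_def
    by (auto simp del: One_nat_def intro!: divide_right_mono)
  then show ?thesis ..
qed

end

(* A minimizer x of |z - s|_Sigma + F(z), where F is the sum of the voters' losses, satisfies
   <grad F(x), u> <= |u|_Sigma for every u, and the opposite inequality for u = s - x. Hence, for the
   outcomes x and z of the target t and of another vote, <grad F(z) - grad F(x), t - x> <= 0.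
   With high probability grad F(z) - grad F(x) is V H (z - x) up to an error eta V |z - x| on the ball
   of radius V^(-1/4) about the limit median g, and all medians lie in that ball, so
   <H (t - x), t - z> >= (1 - O(eta)) <H (t - x), t - x>; the Cauchy-Schwarz inequality and the
   definition of Skew finish the argument. The linear approximation only needs E |g - theta|^-2 to be
   finite, laws of large numbers at the single point g, and that no voter is within O(V^(-1/4)) of g;
   a union bound over the voters gives the last property because the dimension is at least 5. *)
theory Submission
  imports Defs "HOL-Real_Asymp.Real_Asymp"
begin

section \<open>The direction map and its derivative\<close>

text \<open>The radius V^(-1/4) meets two opposing demands. The gradient sum at the limit median
  fluctuates by order V^(1/2), and a single vote shifts it by a bounded amount, while the restoring
  force at distance r is of order V r: so r must be much larger than V^(-1/2). The expected number
  of voters within a distance proportional to r is O(V r^5): so r must be much smaller than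
  V^(-1/5). The exponent 1/4 lies in between. The main obstacle is that the outcomes of two votes
  may be far closer to each other than r, so an error measured by r alone is too coarse; it has to
  be proportional to the distance of the two outcomes. This is why the remainder estimate compares
  two arbitrary points near a common centre, and why the final comparison bounds |z - x| by a
  multiple of |t - x|. Randomness enters only through finitely many scalar sums at one point, and
  the rest is deterministic, which gives all t and s at once. Smoothness of the limit loss is
  derived only on Theta, so the limit median must first be shown to lie there.\<close>

definition sgn_deriv :: "'a::real_inner \<Rightarrow> 'a \<Rightarrow> 'a" where
  "sgn_deriv c v = (v - (sgn c \<bullet> v) *\<^sub>R sgn c) /\<^sub>R norm c"

lemma norm_eq_sgn_inner: "norm a = sgn a \<bullet> (a::'a::real_inner)"
  by (cases "a = 0") (simp_all add: sgn_div_norm dot_square_norm power2_eq_square)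

lemma sgn_inner_le: "sgn b \<bullet> a \<le> norm (a::'a::real_inner)"
proof -
  have "sgn b \<bullet> a \<le> norm (sgn b) * norm a" by (rule norm_cauchy_schwarz)
  also have "\<dots> \<le> 1 * norm a" by (intro mult_right_mono) (auto simp: norm_sgn)
  finally show ?thesis by simp
qed

lemma norm_subgradient: "norm b + sgn b \<bullet> (a - b) \<le> norm (a::'a::real_inner)"
  using sgn_inner_le[of b a] norm_eq_sgn_inner[of b] by (simp add: inner_diff_right)

text \<open>After scaling by \<open>norm b\<close> the difference splits into \<open>a - b\<close>
  and a multiple of \<open>sgn a\<close> with coefficient \<open>norm b - norm a\<close>; each part
  has norm at most \<open>norm (a - b)\<close>. The case \<open>a = 0\<close> is covered.\<close>

lemma norm_sgn_diff_le:
  fixes a b :: "'a::real_inner"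
  assumes "b \<noteq> 0"
  shows "norm (sgn a - sgn b) \<le> 2 * norm (a - b) / norm b"
proof -
  have "norm b *\<^sub>R (sgn a - sgn b) = (a - b) + (norm b - norm a) *\<^sub>R sgn a"
    using assms by (cases "a = 0") (simp_all add: sgn_div_norm algebra_simps)
  then have "norm b * norm (sgn a - sgn b) = norm ((a - b) + (norm b - norm a) *\<^sub>R sgn a)"
    by (metis norm_scaleR abs_norm_cancel)
  also have "\<dots> \<le> norm (a - b) + \<bar>norm b - norm a\<bar> * norm (sgn a)"
    by (metis norm_triangle_ineq norm_scaleR)
  also have "\<dots> \<le> norm (a - b) + norm (a - b) * 1"
    by (intro add_left_mono mult_mono)
      (auto simp: norm_sgn norm_triangle_ineq3 abs_minus_commute[of "norm b"])
  finally show ?thesis using assms by (simp add: field_simps)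
qed

text \<open>The subgradient inequality based at \<open>a\<close> bounds \<open>norm a\<close> from
  above with slope \<open>sgn a\<close>; exchanging that slope for \<open>sgn b\<close> costs the
  Lipschitz bound. With \<open>norm_subgradient\<close> the norm is squeezed between its tangent and
  the tangent plus a square.\<close>

lemma norm_le_second_order:
  fixes a b :: "'a::real_inner"
  assumes "b \<noteq> 0"
  shows "norm a \<le> norm b + sgn b \<bullet> (a - b) + 2 * (norm (a - b))\<^sup>2 / norm b"
proof -
  have "(sgn a - sgn b) \<bullet> (a - b) \<le> norm (sgn a - sgn b) * norm (a - b)"
    by (rule norm_cauchy_schwarz)
  also have "\<dots> \<le> 2 * norm (a - b) / norm b * norm (a - b)"
    by (intro mult_right_mono norm_sgn_diff_le assms) simp
  finally have "(sgn a - sgn b) \<bullet> (a - b) \<le> 2 * (norm (a - b))\<^sup>2 / norm b"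
    by (simp add: power2_eq_square)
  then show ?thesis using norm_subgradient[of a b]
    by (simp add: inner_diff_right inner_diff_left)
qed

lemma linear_sgn_deriv: "linear (sgn_deriv c)"
  unfolding sgn_deriv_def
  by (rule linearI) (simp_all add: algebra_simps inner_add_right scaleR_conv_of_real)

text \<open>\<open>sgn_deriv c\<close> is the orthogonal projection onto the complement of
  \<open>c\<close>, divided by \<open>norm c\<close>: the Hessian of the norm at \<open>c\<close>.
  This explains its symmetry and positivity. At \<open>c = 0\<close> division by zero makes it
  0.\<close>

lemma sgn_deriv_sym: "sgn_deriv c v \<bullet> w = v \<bullet> sgn_deriv c w"
  unfolding sgn_deriv_def by (simp add: inner_diff_left inner_diff_right inner_commute)

lemma inner_sgn_deriv:
  "v \<bullet> sgn_deriv c v = ((norm v)\<^sup>2 - (sgn c \<bullet> v)\<^sup>2) / norm c"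
  unfolding sgn_deriv_def
  by (simp add: inner_diff_right inner_commute divide_inverse power2_eq_square dot_square_norm
      mult.commute)

lemma inner_sgn_deriv_nonneg: "0 \<le> v \<bullet> sgn_deriv c v"
proof -
  have "\<bar>sgn c \<bullet> v\<bar> \<le> norm v"
    using sgn_inner_le[of c v] sgn_inner_le[of c "- v"] by simp
  then have "(sgn c \<bullet> v)\<^sup>2 \<le> (norm v)\<^sup>2" by (metis abs_norm_cancel abs_le_square_iff)
  then show ?thesis by (simp add: inner_sgn_deriv)
qed

lemma norm_sub_proj_le: "norm (v - (sgn c \<bullet> v) *\<^sub>R sgn c) \<le> norm (v::'a::real_inner)"
proof -
  have "(norm (v - (sgn c \<bullet> v) *\<^sub>R sgn c))\<^sup>2
      = (norm v)\<^sup>2 - 2 * (sgn c \<bullet> v)\<^sup>2 + (sgn c \<bullet> v)\<^sup>2 * (norm (sgn c))\<^sup>2"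
    unfolding power2_norm_eq_inner
    by (simp add: inner_diff_left inner_diff_right inner_commute power2_eq_square algebra_simps)
  also have "\<dots> \<le> (norm v)\<^sup>2"
    by (cases "c = 0") (simp_all add: norm_sgn)
  finally show ?thesis by (simp add: power2_le_iff_abs_le)
qed

lemma norm_sgn_deriv_le: "norm (sgn_deriv c v) \<le> norm v / norm c"
  unfolding sgn_deriv_def using norm_sub_proj_le[of v c]
  by (simp add: divide_inverse mult.commute[of "norm v"] mult_left_mono)

text \<open>Multiplied by \<open>norm c\<close>, the remainder is a product of two first-order
  differences plus the defect \<open>sgn c \<bullet> a - norm a\<close>, which is itself of second
  order. The estimate holds for every \<open>a\<close>, not only near \<open>c\<close>, and so can
  be integrated over all voters.\<close>

lemma norm_sgn_remainder_le:
  fixes a c :: "'a::real_inner"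
  assumes "c \<noteq> 0"
  shows "norm (sgn a - sgn c - sgn_deriv c (a - c)) \<le> 4 * (norm (a - c))\<^sup>2 / (norm c)\<^sup>2"
proof -
  define \<Delta> where "\<Delta> = norm (sgn a - sgn c)"
  have c0: "norm c > 0" using assms by simp
  have id: "norm c *\<^sub>R (sgn a - sgn c - sgn_deriv c (a - c))
      = (norm c - norm a) *\<^sub>R (sgn a - sgn c) + (sgn c \<bullet> a - norm a) *\<^sub>R sgn c"
  proof -
    have e: "norm a *\<^sub>R sgn a = a" "norm c *\<^sub>R sgn c = c"
      by (cases "a = 0"; simp add: sgn_div_norm) (simp add: sgn_div_norm assms)
    have "norm c *\<^sub>R sgn_deriv c (a - c) = (a - c) - (sgn c \<bullet> a - norm c) *\<^sub>R sgn c"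
      unfolding sgn_deriv_def using c0 norm_eq_sgn_inner[of c] by (simp add: inner_diff_right)
    then show ?thesis using e by (simp add: scaleR_diff_right scaleR_diff_left)
  qed
  have d1: "\<Delta> \<le> 2 * norm (a - c) / norm c"
    unfolding \<Delta>_def by (rule norm_sgn_diff_le[OF assms])
  have "norm ((norm c - norm a) *\<^sub>R (sgn a - sgn c)) \<le> norm (a - c) * (2 * norm (a - c) / norm c)"
    unfolding norm_scaleR
    by (intro mult_mono d1[unfolded \<Delta>_def])
      (auto simp: norm_triangle_ineq3 abs_minus_commute[of "norm c"])
  moreover have "\<bar>sgn c \<bullet> a - norm a\<bar> \<le> 2 * (norm (a - c))\<^sup>2 / norm c"
  proof (cases "a = 0")
    case False
    have "\<Delta>\<^sup>2 = 2 - 2 * (sgn c \<bullet> sgn a)"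
    proof -
      have "sgn a \<bullet> sgn a = 1" "sgn c \<bullet> sgn c = 1"
        using False assms by (simp_all add: norm_sgn flip: power2_norm_eq_inner)
      then show ?thesis
        unfolding \<Delta>_def power2_norm_eq_inner
        by (simp add: inner_diff_left inner_diff_right inner_commute[of "sgn a" "sgn c"])
    qed
    then have "norm a * \<Delta>\<^sup>2 = 2 * (norm a - sgn c \<bullet> (norm a *\<^sub>R sgn a))"
      by (simp only: inner_scaleR_right) (simp add: right_diff_distrib mult.left_commute)
    also have "norm a *\<^sub>R sgn a = a" using False by (simp add: sgn_div_norm)
    finally have 1: "norm a - sgn c \<bullet> a = norm a * \<Delta>\<^sup>2 / 2" by simp
    \<comment> \<open>The Lipschitz bound is applied once based at \<open>a\<close> and once at
      \<open>c\<close>: the first cancels the factor \<open>norm a\<close>, so no lower bound on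
      \<open>norm a\<close> enters.\<close>
    have "\<Delta> \<le> 2 * norm (c - a) / norm a"
      unfolding \<Delta>_def using norm_sgn_diff_le[OF False, of c] by (simp add: norm_minus_commute)
    then have "\<Delta> * \<Delta> \<le> (2 * norm (c - a) / norm a) * (2 * norm (a - c) / norm c)"
      using d1 by (intro mult_mono) (auto simp: \<Delta>_def)
    then have "norm a * \<Delta>\<^sup>2 / 2 \<le> 2 * (norm (a - c))\<^sup>2 / norm c"
      using False c0 by (simp add: field_simps power2_eq_square norm_minus_commute)
    then show ?thesis using 1 sgn_inner_le[of c a] by simp
  qed (use c0 in simp)
  moreover have "norm (sgn c) = 1" using assms by (simp add: norm_sgn)
  ultimately have "norm ((norm c - norm a) *\<^sub>R (sgn a - sgn c) + (sgn c \<bullet> a - norm a) *\<^sub>R sgn c)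
      \<le> norm (a - c) * (2 * norm (a - c) / norm c) + 2 * (norm (a - c))\<^sup>2 / norm c"
    by (intro norm_triangle_mono) auto
  then have "norm c * norm (sgn a - sgn c - sgn_deriv c (a - c)) \<le> 4 * (norm (a - c))\<^sup>2 / norm c"
    unfolding id[symmetric] by (simp add: power2_eq_square)
  then show ?thesis using c0 by (simp add: field_simps power2_eq_square)
qed

text \<open>Both the factor 1 / |b| and the projection change by O(|b - c| / |c|), as
  \<open>b\<close> stays away from the origin. The contributions 2 and 4 are rounded up to
  8.\<close>

lemma norm_sgn_deriv_diff_le:
  fixes b c v :: "'a::real_inner"
  assumes "c \<noteq> 0" "norm c \<le> 2 * norm b"
  shows "norm (sgn_deriv b v - sgn_deriv c v) \<le> 8 * norm (b - c) * norm v / (norm c)\<^sup>2"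
proof -
  have c0: "norm c > 0" and b0: "norm b > 0" using assms by (auto intro: ccontr)
  have "sgn_deriv b v - sgn_deriv c v
      = (1 / norm b - 1 / norm c) *\<^sub>R (v - (sgn b \<bullet> v) *\<^sub>R sgn b)
        + (1 / norm c) *\<^sub>R (((sgn c - sgn b) \<bullet> v) *\<^sub>R sgn c + (sgn b \<bullet> v) *\<^sub>R (sgn c - sgn b))"
    unfolding sgn_deriv_def by (simp add: algebra_simps inner_diff_left divide_inverse)
  also have "norm \<dots> \<le> \<bar>1 / norm b - 1 / norm c\<bar> * norm v
      + (1 / norm c) * (norm (sgn c - sgn b) * norm v * 1 + norm v * norm (sgn c - sgn b))"
  proof (intro norm_triangle_mono)
    show "norm ((1 / norm b - 1 / norm c) *\<^sub>R (v - (sgn b \<bullet> v) *\<^sub>R sgn b))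
        \<le> \<bar>1 / norm b - 1 / norm c\<bar> * norm v"
      unfolding norm_scaleR by (intro mult_left_mono norm_sub_proj_le) simp
    have *: "\<bar>sgn b \<bullet> v\<bar> \<le> norm v"
      using sgn_inner_le[of b v] sgn_inner_le[of b "- v"] by simp
    have "norm (((sgn c - sgn b) \<bullet> v) *\<^sub>R sgn c + (sgn b \<bullet> v) *\<^sub>R (sgn c - sgn b))
      \<le> norm (sgn c - sgn b) * norm v * 1 + norm v * norm (sgn c - sgn b)"
      by (intro norm_triangle_mono; unfold norm_scaleR; intro mult_mono)
        (auto simp: Cauchy_Schwarz_ineq2 norm_sgn *)
    then show "norm ((1 / norm c) *\<^sub>R (((sgn c - sgn b) \<bullet> v) *\<^sub>R sgn c + (sgn b \<bullet> v) *\<^sub>R (sgn c - sgn b)))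
       \<le> (1 / norm c) * (norm (sgn c - sgn b) * norm v * 1 + norm v * norm (sgn c - sgn b))"
      unfolding norm_scaleR using c0 by (simp add: divide_right_mono)
  qed
  also have "\<dots> \<le> (2 * norm (b - c) / (norm c)\<^sup>2) * norm v
      + (1 / norm c) * (2 * (2 * norm (b - c) / norm c) * norm v)"
  proof (intro add_mono mult_right_mono mult_left_mono)
    have "\<bar>1 / norm b - 1 / norm c\<bar> = \<bar>norm c - norm b\<bar> / (norm b * norm c)"
      using b0 c0 by (simp add: field_simps abs_div)
    also have "\<dots> \<le> norm (b - c) / (norm b * norm c)"
      using norm_triangle_ineq3[of b c] b0 c0
      by (intro divide_right_mono) (auto simp: abs_minus_commute)
    also have "\<dots> \<le> norm (b - c) / (norm c / 2 * norm c)"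
      using assms(2) b0 c0 by (intro divide_left_mono mult_right_mono) auto
    finally show "\<bar>1 / norm b - 1 / norm c\<bar> \<le> 2 * norm (b - c) / (norm c)\<^sup>2"
      by (simp add: power2_eq_square field_simps)
    have "norm (sgn c - sgn b) \<le> 2 * norm (b - c) / norm c"
      using norm_sgn_diff_le[OF assms(1), of b] by (simp add: norm_minus_commute)
    then show "norm (sgn c - sgn b) * norm v * 1 + norm v * norm (sgn c - sgn b)
        \<le> 2 * (2 * norm (b - c) / norm c) * norm v"
      using mult_right_mono[of "2 * norm (sgn c - sgn b)" "2 * (2 * norm (b - c) / norm c)" "norm v"]
      by (simp add: algebra_simps)
  qed auto
  also have "\<dots> \<le> 8 * norm (b - c) * norm v / (norm c)\<^sup>2"
    using c0 by (simp add: field_simps power2_eq_square)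
  finally show ?thesis .
qed

text \<open>The two-point form of the expansion. At \<open>b\<close> the error is quadratic in
  \<open>a - b\<close>, and one factor is traded for 2 \<rho>; moving the derivative from
  \<open>b\<close> to \<open>c\<close> costs another multiple of \<rho> |a - b|. The error thus
  stays proportional to |a - b|, with 40 = 32 + 8.\<close>

lemma norm_sgn_diff_remainder_le:
  fixes a b c :: "'a::real_inner"
  assumes "c \<noteq> 0" "norm (a - c) \<le> \<rho>" "norm (b - c) \<le> \<rho>" "2 * \<rho> \<le> norm c"
  shows "norm (sgn a - sgn b - sgn_deriv c (a - b)) \<le> 40 * \<rho> * norm (a - b) / (norm c)\<^sup>2"
proof -
  have c0: "norm c > 0" using assms by simp
  have r0: "\<rho> \<ge> 0" using assms(2) norm_ge_zero order_trans by blast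
  have bc: "norm c \<le> 2 * norm b"
    using assms(3,4) norm_triangle_ineq2[of c b] by (simp add: norm_minus_commute)
  then have b: "b \<noteq> 0" "norm b > 0" using c0 by auto
  have ab: "norm (a - b) \<le> 2 * \<rho>"
    using assms(2,3) norm_triangle_sub[of "a - c" "b - c"] norm_triangle_ineq4[of "a - c" "b - c"]
    by simp
  have "norm (sgn a - sgn b - sgn_deriv b (a - b)) \<le> 4 * (norm (a - b))\<^sup>2 / (norm b)\<^sup>2"
    by (rule norm_sgn_remainder_le[OF b(1)])
  also have "\<dots> \<le> 4 * (2 * \<rho> * norm (a - b)) / (norm c / 2)\<^sup>2"
    using ab bc c0 r0 unfolding power2_eq_square
    by (intro frac_le mult_mono mult_nonneg_nonneg mult_right_mono mult_left_mono) auto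
  finally have 1: "norm (sgn a - sgn b - sgn_deriv b (a - b)) \<le> 32 * \<rho> * norm (a - b) / (norm c)\<^sup>2"
    by (simp add: power2_eq_square)
  have "norm (sgn_deriv b (a - b) - sgn_deriv c (a - b))
      \<le> 8 * norm (b - c) * norm (a - b) / (norm c)\<^sup>2"
    by (rule norm_sgn_deriv_diff_le[OF assms(1) bc])
  also have "\<dots> \<le> 8 * \<rho> * norm (a - b) / (norm c)\<^sup>2"
    using assms(3) by (intro divide_right_mono mult_right_mono mult_left_mono) auto
  finally have 2: "norm (sgn_deriv b (a - b) - sgn_deriv c (a - b))
      \<le> 8 * \<rho> * norm (a - b) / (norm c)\<^sup>2" .
  have "norm (sgn a - sgn b - sgn_deriv c (a - b))
      = norm ((sgn a - sgn b - sgn_deriv b (a - b)) + (sgn_deriv b (a - b) - sgn_deriv c (a - b)))"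
    by simp
  also have "\<dots> \<le> 32 * \<rho> * norm (a - b) / (norm c)\<^sup>2 + 8 * \<rho> * norm (a - b) / (norm c)\<^sup>2"
    by (rule norm_triangle_mono[OF 1 2])
  finally show ?thesis by (simp add: add_divide_distrib[symmetric])
qed

section \<open>Positive definite matrices and skewness\<close>

lemma pos_def_inner_commute:
  assumes "pos_def_matrix A"
  shows "(A *v x) \<bullet> y = x \<bullet> (A *v y)"
  using assms by (metis dot_lmul_matrix pos_def_matrix_def transpose_matrix_vector)

lemma matrix_vector_norm_bound:
  fixes A :: "real^'d^'e"
  obtains C where "C > 0" "\<And>x. norm (A *v x) \<le> C * norm x"
proof -
  obtain B where "B > 0" "\<And>x. norm (A *v x) \<le> B * norm x"
    using linear_bounded_pos[of "(*v) A"] by auto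
  then show ?thesis by (rule that)
qed

text \<open>The minimum of the quadratic form over the unit sphere is attained by compactness, hence
  positive; it serves as \<kappa>, and scaling does the rest.\<close>

lemma pos_def_quadratic_bound:
  fixes A :: "real^'d^'d"
  assumes "pos_def_matrix A"
  obtains \<kappa> where "\<kappa> > 0" "\<And>x. \<kappa> * (norm x)\<^sup>2 \<le> x \<bullet> (A *v x)"
proof -
  have lin: "linear ((*v) A)" by simp
  have "continuous_on (sphere 0 1) (\<lambda>x::real^'d. x \<bullet> (A *v x))"
    by (intro continuous_intros linear_continuous_on_compose[OF _ lin])
  moreover have "sphere 0 1 \<noteq> ({}::(real^'d) set)" by simp
  ultimately obtain u where u: "u \<in> sphere 0 1"
    "\<And>x. x \<in> sphere 0 1 \<Longrightarrow> u \<bullet> (A *v u) \<le> x \<bullet> (A *v x)"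
    using continuous_attains_inf[OF compact_sphere, of 0 1 "\<lambda>x::real^'d. x \<bullet> (A *v x)"] by blast
  show ?thesis
  proof (rule that)
    have "u \<noteq> 0" using u(1) by auto
    then show "u \<bullet> (A *v u) > 0" using assms by (simp add: pos_def_matrix_def)
    show "u \<bullet> (A *v u) * (norm x)\<^sup>2 \<le> x \<bullet> (A *v x)" for x
    proof (cases "x = 0")
      case False
      then have "u \<bullet> (A *v u) \<le> sgn x \<bullet> (A *v sgn x)" by (intro u) (simp add: norm_sgn)
      also have "\<dots> = (x \<bullet> (A *v x)) / (norm x)\<^sup>2"
        by (simp add: sgn_div_norm matrix_vector_mult_scaleR divide_inverse power2_eq_square
            algebra_simps)
      finally show ?thesis using False by (simp add: pos_le_divide_eq)
    qed simp
  qed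
qed

lemma pos_def_norm_bound:
  fixes A :: "real^'d^'d"
  assumes "pos_def_matrix A"
  obtains c where "c > 0" "\<And>x. c * norm x \<le> norm (A *v x)"
proof -
  obtain \<kappa> where \<kappa>: "\<kappa> > 0" "\<And>x. \<kappa> * (norm x)\<^sup>2 \<le> x \<bullet> (A *v x)"
    using pos_def_quadratic_bound[OF assms] by blast
  have "\<kappa> * norm x \<le> norm (A *v x)" for x
  proof (cases "x = 0")
    case False
    have "\<kappa> * norm x * norm x \<le> norm (A *v x) * norm x"
      using \<kappa>(2)[of x] norm_cauchy_schwarz[of x "A *v x"] by (simp add: power2_eq_square algebra_simps)
    then show ?thesis using False by simp
  qed simp
  with \<kappa>(1) show ?thesis by (rule that)
qed

lemma pos_def_vector_eq_0_iff:
  assumes "pos_def_matrix A"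
  shows "A *v x = 0 \<longleftrightarrow> x = 0"
  using assms by (metis inner_zero_right less_irrefl matrix_vector_mult_0_right pos_def_matrix_def)

lemma pos_def_matrix_inv:
  fixes A :: "real^'d^'d"
  assumes "pos_def_matrix A"
  shows "A ** matrix_inv A = mat 1" "matrix_inv A ** A = mat 1"
    "transpose (matrix_inv A) = matrix_inv A"
proof -
  have "inj ((*v) A)"
    using pos_def_vector_eq_0_iff[OF assms] by (simp add: linear_injective_0)
  then have "invertible A"
    by (simp add: invertible_left_inverse matrix_left_invertible_injective)
  then have "A ** matrix_inv A = mat 1 \<and> matrix_inv A ** A = mat 1"
    unfolding invertible_def matrix_inv_def by (rule someI_ex)
  then show 1: "A ** matrix_inv A = mat 1" and 2: "matrix_inv A ** A = mat 1" by auto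
  have "transpose (matrix_inv A) ** A = mat 1"
    using arg_cong[OF 1, of transpose] assms
    by (simp add: matrix_transpose_mul pos_def_matrix_def transpose_mat)
  then show "transpose (matrix_inv A) = matrix_inv A"
    by (metis 1 matrix_mul_assoc matrix_mul_lid matrix_mul_rid)
qed

text \<open>The quotient under the supremum is at most \<open>C / \<kappa>\<close>, so the
  real-valued \<open>SUP\<close> is a genuine upper bound and can be used without division.\<close>

lemma Skew_bound:
  fixes A :: "real^'d^'d"
  assumes "pos_def_matrix A"
  shows "norm x * norm (A *v x) \<le> (1 + Skew A) * (x \<bullet> (A *v x))"
proof (cases "x = 0")
  case False
  obtain \<kappa> where \<kappa>: "\<kappa> > 0" "\<And>x. \<kappa> * (norm x)\<^sup>2 \<le> x \<bullet> (A *v x)"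
    using pos_def_quadratic_bound[OF assms] by blast
  obtain C where C: "C > 0" "\<And>x. norm (A *v x) \<le> C * norm x"
    using matrix_vector_norm_bound[of A] by blast
  have "norm y * norm (A *v y) / (y \<bullet> (A *v y)) - 1 \<le> C / \<kappa> - 1" if "y \<noteq> 0" for y
  proof -
    have "norm y * norm (A *v y) \<le> norm y * (C * norm y)" using C by (intro mult_left_mono) auto
    also have "\<dots> = C / \<kappa> * (\<kappa> * (norm y)\<^sup>2)" using \<kappa> by (simp add: power2_eq_square)
    also have "\<dots> \<le> C / \<kappa> * (y \<bullet> (A *v y))" using C \<kappa> by (intro mult_left_mono) auto
    finally show ?thesis
      using that assms by (simp add: pos_def_matrix_def divide_le_eq)
  qed
  then have "bdd_above ((\<lambda>x. norm x * norm (A *v x) / (x \<bullet> (A *v x)) - 1) ` {x. x \<noteq> 0})"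
    by (intro bdd_aboveI2[where M = "C / \<kappa> - 1"]) auto
  then have "norm x * norm (A *v x) / (x \<bullet> (A *v x)) - 1 \<le> Skew A"
    unfolding Skew_def using False by (intro cSUP_upper) auto
  then show ?thesis
    using False assms by (simp add: pos_def_matrix_def divide_le_eq field_simps)
qed simp

lemma Skew_nonneg:
  fixes A :: "real^'d^'d"
  assumes "pos_def_matrix A"
  shows "0 \<le> Skew A"
proof -
  obtain e :: "real^'d" where e: "norm e = 1" using vector_choose_size[of 1] by auto
  then have "e \<noteq> 0" by auto
  then have "e \<bullet> (A *v e) > 0" using assms by (simp add: pos_def_matrix_def)
  moreover have "1 * (e \<bullet> (A *v e)) \<le> (1 + Skew A) * (e \<bullet> (A *v e))"
    using Skew_bound[OF assms, of e] norm_cauchy_schwarz[of e "A *v e"] by simp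
  ultimately have "1 \<le> 1 + Skew A" by (rule mult_right_le_imp_le[rotated])
  then show ?thesis by simp
qed

lemma pos_def_conjugate:
  fixes H S :: "real^'d^'d"
  assumes H: "pos_def_matrix H" and S: "pos_def_matrix S"
  shows "pos_def_matrix (matrix_inv S ** H ** matrix_inv S)"
  unfolding pos_def_matrix_def
proof (intro conjI allI impI)
  note SI = pos_def_matrix_inv[OF S]
  show "transpose (matrix_inv S ** H ** matrix_inv S) = matrix_inv S ** H ** matrix_inv S"
    using H by (simp add: matrix_transpose_mul SI pos_def_matrix_def matrix_mul_assoc)
  fix x :: "real^'d" assume "x \<noteq> 0"
  then have "matrix_inv S *v x \<noteq> 0"
    using SI(1) matrix_left_invertible_ker by blast
  then have "0 < (matrix_inv S *v x) \<bullet> (H *v (matrix_inv S *v x))"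
    using H by (simp add: pos_def_matrix_def)
  also have "\<dots> = x \<bullet> ((matrix_inv S ** H ** matrix_inv S) *v x)"
    by (metis SI(3) dot_lmul_matrix matrix_vector_mul_assoc transpose_matrix_vector)
  finally show "0 < x \<bullet> ((matrix_inv S ** H ** matrix_inv S) *v x)" .
qed

text \<open>Estimates \<open>F\<close> from below on the sphere of radius \<open>r\<close> through the midpoint of the segment
  from \<open>g\<close>, so that subgradients replace second-order Taylor expansion.\<close>

lemma convex_localisation:
  fixes F :: "'a::real_inner \<Rightarrow> real"
  assumes sub: "\<And>x y. F x + G x \<bullet> (y - x) \<le> F y"
    and mono: "\<And>y. norm (y - g) \<le> r \<Longrightarrow> m * (norm (y - g))\<^sup>2 \<le> (G y - G g) \<bullet> (y - g)"
    and r: "r > 0" and m: "norm (G g) + C < m * r / 4"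
    and x: "F x - F g \<le> C * norm (x - g)"
  shows "norm (x - g) \<le> r"
proof (rule ccontr)
  define R where "R = norm (x - g)"
  define l where "l = r / R"
  define e where "e = (l / 2) *\<^sub>R (x - g)"
  assume "\<not> norm (x - g) \<le> r"
  then have R: "R > r" "R > 0" using r by (auto simp: R_def)
  then have l: "0 < l" "l < 1" "l * R = r" using r by (auto simp: l_def)
  have ne: "norm e = r / 2" using l(1,3) by (simp add: e_def R_def[symmetric])
  define z p where "z = g + 2 *\<^sub>R e" and "p = g + e"
  have zx: "x - z = (1 - l) *\<^sub>R (x - g)" "g - z = - (l *\<^sub>R (x - g))"
    by (simp_all add: z_def e_def algebra_simps)
  \<comment> \<open>Convexity between \<open>g\<close> and \<open>x\<close>: since \<open>z\<close>
    is the combination of \<open>x\<close> and \<open>g\<close> with weights \<open>l\<close> and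
    \<open>1 - l\<close>, the two inner products cancel.\<close>
  have "l * (F z + G z \<bullet> (x - z)) + (1 - l) * (F z + G z \<bullet> (g - z)) \<le> l * F x + (1 - l) * F g"
    using l by (intro add_mono mult_left_mono sub) auto
  then have "F z - F g \<le> l * (F x - F g)"
    unfolding zx by (simp add: algebra_simps)
  also have "\<dots> \<le> l * (C * R)" using x l by (intro mult_left_mono) (auto simp: R_def)
  also have "\<dots> = C * r" using l(3) by (simp add: mult.left_commute mult.commute)
  finally have up: "F z - F g \<le> C * r" .
  \<comment> \<open>Chaining the subgradients at \<open>p\<close> and \<open>g\<close> gives a
    growth of (G p - G g) \<bullet> e + 2 G g \<bullet> e. Strong monotonicity is applied at
    distance r / 2, whence the factor 1/4 in the condition on \<open>m\<close>.\<close>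
  have "F p + G p \<bullet> e \<le> F z" using sub[of p z] by (simp add: p_def z_def scaleR_2)
  moreover have "F g + G g \<bullet> e \<le> F p" using sub[of g p] by (simp add: p_def)
  moreover have "m * (r / 2)\<^sup>2 \<le> (G p - G g) \<bullet> e"
    using mono[of p] ne r by (simp add: p_def)
  moreover have "- (norm (G g) * (r / 2)) \<le> G g \<bullet> e"
    using Cauchy_Schwarz_ineq2[of "G g" e] ne by (simp add: abs_le_iff)
  ultimately have "m * (r / 2)\<^sup>2 - norm (G g) * r \<le> F z - F g"
    by (simp add: inner_diff_left)
  with up have "r * (m * r / 4) \<le> r * (norm (G g) + C)"
    by (simp add: power2_eq_square algebra_simps)
  then show False using m r by simp
qed

text \<open>Division by \<open>h\<close> and \<open>h\<close> tending to 0. In this form minimality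
  yields one-sided first-order conditions although the distance to the vote may have its kink at the
  minimizer.\<close>

lemma le_of_quadratic_perturbation:
  fixes a b K :: real
  assumes "\<And>h. 0 < h \<Longrightarrow> h \<le> 1 \<Longrightarrow> h * a \<le> h * b + h\<^sup>2 * K"
  shows "a \<le> b"
proof (rule ccontr)
  assume "\<not> a \<le> b"
  define h where "h = min 1 ((a - b) / (2 * (\<bar>K\<bar> + 1)))"
  have h: "0 < h" "h \<le> 1" using \<open>\<not> a \<le> b\<close> by (auto simp: h_def)
  have "h * a \<le> h * (b + h * K)" using assms[OF h] by (simp add: power2_eq_square algebra_simps)
  then have "a \<le> b + h * K" using h(1) by simp
  have "h * K \<le> h * (\<bar>K\<bar> + 1)" using h by (intro mult_left_mono) auto
  also have "\<dots> \<le> (a - b) / (2 * (\<bar>K\<bar> + 1)) * (\<bar>K\<bar> + 1)"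
    by (intro mult_right_mono) (auto simp: h_def)
  also have "\<dots> = (a - b) / 2" by (simp add: field_simps)
  finally have "2 * (h * K) \<le> a - b" by simp
  then show False using \<open>\<not> a \<le> b\<close> \<open>a \<le> b + h * K\<close> by linarith
qed

section \<open>Skewed losses and first-order conditions\<close>

text \<open>The gradient of \<open>mnorm \<Sigma>\<close> away from 0, for symmetric \<Sigma>. At 0
  the value is 0, which is still a subgradient, so convexity estimates need no case distinction when
  a point coincides with a voter.\<close>

definition mnorm_grad :: "real^'d^'d \<Rightarrow> real^'d \<Rightarrow> real^'d" where
  "mnorm_grad \<Sigma> w = \<Sigma> *v sgn (\<Sigma> *v w)"

definition mnorm_hess :: "real^'d^'d \<Rightarrow> real^'d \<Rightarrow> real^'d \<Rightarrow> real^'d" where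
  "mnorm_hess \<Sigma> w v = \<Sigma> *v sgn_deriv (\<Sigma> *v w) (\<Sigma> *v v)"

lemma mnorm_subgradient:
  assumes "pos_def_matrix \<Sigma>"
  shows "mnorm \<Sigma> w + mnorm_grad \<Sigma> w \<bullet> (y - w) \<le> mnorm \<Sigma> y"
  using norm_subgradient[of "\<Sigma> *v w" "\<Sigma> *v y"]
  by (simp add: mnorm_def mnorm_grad_def pos_def_inner_commute[OF assms]
      matrix_vector_mult_diff_distrib)

lemma mnorm_le_second_order:
  assumes "pos_def_matrix \<Sigma>" "w \<noteq> 0"
  shows "mnorm \<Sigma> y \<le> mnorm \<Sigma> w + mnorm_grad \<Sigma> w \<bullet> (y - w)
           + 2 * (norm (\<Sigma> *v (y - w)))\<^sup>2 / norm (\<Sigma> *v w)"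
  using norm_le_second_order[of "\<Sigma> *v w" "\<Sigma> *v y"] assms
  by (simp add: mnorm_def mnorm_grad_def pos_def_inner_commute[OF assms(1)]
      matrix_vector_mult_diff_distrib pos_def_vector_eq_0_iff)

lemma norm_mnorm_grad_le:
  assumes "\<And>x. norm (\<Sigma> *v x) \<le> C * norm x" "0 \<le> C"
  shows "norm (mnorm_grad \<Sigma> w) \<le> C"
proof -
  have "norm (mnorm_grad \<Sigma> w) \<le> C * norm (sgn (\<Sigma> *v w))"
    unfolding mnorm_grad_def by (rule assms)
  also have "\<dots> \<le> C * 1" using assms(2) by (intro mult_left_mono) (auto simp: norm_sgn)
  finally show ?thesis by simp
qed

lemma linear_mnorm_hess: "linear (mnorm_hess \<Sigma> w)"
proof -
  have "mnorm_hess \<Sigma> w = (*v) \<Sigma> \<circ> (sgn_deriv (\<Sigma> *v w) \<circ> (*v) \<Sigma>)"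
    by (simp add: mnorm_hess_def fun_eq_iff)
  then show ?thesis by (auto intro!: linear_compose linear_sgn_deriv)
qed

lemma mnorm_hess_sym:
  assumes "pos_def_matrix \<Sigma>"
  shows "mnorm_hess \<Sigma> w v \<bullet> v' = v \<bullet> mnorm_hess \<Sigma> w v'"
proof -
  have "mnorm_hess \<Sigma> w v \<bullet> v' = sgn_deriv (\<Sigma> *v w) (\<Sigma> *v v) \<bullet> (\<Sigma> *v v')"
    unfolding mnorm_hess_def by (rule pos_def_inner_commute[OF assms])
  also have "\<dots> = (\<Sigma> *v v) \<bullet> sgn_deriv (\<Sigma> *v w) (\<Sigma> *v v')" by (rule sgn_deriv_sym)
  also have "\<dots> = v \<bullet> mnorm_hess \<Sigma> w v'"
    unfolding mnorm_hess_def by (rule pos_def_inner_commute[OF assms])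
  finally show ?thesis .
qed

lemma inner_mnorm_hess:
  assumes "pos_def_matrix \<Sigma>"
  shows "v \<bullet> mnorm_hess \<Sigma> w v
    = ((norm (\<Sigma> *v v))\<^sup>2 - (sgn (\<Sigma> *v w) \<bullet> (\<Sigma> *v v))\<^sup>2) / norm (\<Sigma> *v w)"
  unfolding mnorm_hess_def inner_sgn_deriv[symmetric]
  by (rule pos_def_inner_commute[OF assms, symmetric])

lemma norm_mnorm_hess_le:
  assumes "\<And>x. norm (\<Sigma> *v x) \<le> C * norm x" "0 \<le> C"
  shows "norm (mnorm_hess \<Sigma> w v) \<le> C\<^sup>2 * norm v / norm (\<Sigma> *v w)"
proof -
  have "norm (mnorm_hess \<Sigma> w v) \<le> C * norm (sgn_deriv (\<Sigma> *v w) (\<Sigma> *v v))"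
    unfolding mnorm_hess_def by (rule assms)
  also have "\<dots> \<le> C * (norm (\<Sigma> *v v) / norm (\<Sigma> *v w))"
    by (intro mult_left_mono norm_sgn_deriv_le assms)
  also have "\<dots> \<le> C * (C * norm v / norm (\<Sigma> *v w))"
    by (intro mult_left_mono divide_right_mono assms) auto
  finally show ?thesis by (simp add: power2_eq_square)
qed

lemma norm_mnorm_grad_remainder_le:
  assumes "pos_def_matrix \<Sigma>" "\<And>x. norm (\<Sigma> *v x) \<le> C * norm x" "0 \<le> C" "w \<noteq> 0"
  shows "norm (mnorm_grad \<Sigma> y - mnorm_grad \<Sigma> w - mnorm_hess \<Sigma> w (y - w))
           \<le> 4 * C ^ 3 * (norm (y - w))\<^sup>2 / (norm (\<Sigma> *v w))\<^sup>2"
proof -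
  have "norm (mnorm_grad \<Sigma> y - mnorm_grad \<Sigma> w - mnorm_hess \<Sigma> w (y - w))
      = norm (\<Sigma> *v (sgn (\<Sigma> *v y) - sgn (\<Sigma> *v w) - sgn_deriv (\<Sigma> *v w) (\<Sigma> *v y - \<Sigma> *v w)))"
    by (simp add: mnorm_grad_def mnorm_hess_def matrix_vector_mult_diff_distrib)
  also have "\<dots> \<le> C * norm (sgn (\<Sigma> *v y) - sgn (\<Sigma> *v w)
      - sgn_deriv (\<Sigma> *v w) (\<Sigma> *v y - \<Sigma> *v w))" by (rule assms)
  also have "\<dots> \<le> C * (4 * (norm (\<Sigma> *v y - \<Sigma> *v w))\<^sup>2 / (norm (\<Sigma> *v w))\<^sup>2)"
    using assms by (intro mult_left_mono norm_sgn_remainder_le) (simp_all add: pos_def_vector_eq_0_iff)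
  also have "\<dots> \<le> C * (4 * (C * norm (y - w))\<^sup>2 / (norm (\<Sigma> *v w))\<^sup>2)"
    using assms(2)[of "y - w"] assms(3)
    by (intro mult_left_mono divide_right_mono power_mono)
      (auto simp: matrix_vector_mult_diff_distrib)
  finally show ?thesis by (simp add: power2_eq_square power3_eq_cube algebra_simps)
qed

lemma norm_mnorm_grad_diff_remainder_le:
  assumes "\<And>x. norm (\<Sigma> *v x) \<le> C * norm x" "0 \<le> C"
    and "\<Sigma> *v w \<noteq> 0" "norm (y - w) \<le> r" "norm (z - w) \<le> r" "2 * C * r \<le> norm (\<Sigma> *v w)"
  shows "norm (mnorm_grad \<Sigma> y - mnorm_grad \<Sigma> z - mnorm_hess \<Sigma> w (y - z))
           \<le> 40 * C ^ 3 * r * norm (y - z) / (norm (\<Sigma> *v w))\<^sup>2"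
proof -
  have r: "0 \<le> r" using assms(4) norm_ge_zero order_trans by blast
  have b: "norm (\<Sigma> *v y - \<Sigma> *v w) \<le> C * r" "norm (\<Sigma> *v z - \<Sigma> *v w) \<le> C * r"
    using order_trans[OF assms(1)[of "y - w"] mult_left_mono[OF assms(4,2)]]
      order_trans[OF assms(1)[of "z - w"] mult_left_mono[OF assms(5,2)]]
    by (simp_all add: matrix_vector_mult_diff_distrib)
  have "norm (mnorm_grad \<Sigma> y - mnorm_grad \<Sigma> z - mnorm_hess \<Sigma> w (y - z))
      = norm (\<Sigma> *v (sgn (\<Sigma> *v y) - sgn (\<Sigma> *v z) - sgn_deriv (\<Sigma> *v w) (\<Sigma> *v y - \<Sigma> *v z)))"
    by (simp add: mnorm_grad_def mnorm_hess_def matrix_vector_mult_diff_distrib)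
  also have "\<dots> \<le> C * norm (sgn (\<Sigma> *v y) - sgn (\<Sigma> *v z)
      - sgn_deriv (\<Sigma> *v w) (\<Sigma> *v y - \<Sigma> *v z))" by (rule assms)
  also have "\<dots> \<le> C * (40 * (C * r) * norm (\<Sigma> *v y - \<Sigma> *v z) / (norm (\<Sigma> *v w))\<^sup>2)"
    using assms(2,3,6) b
    by (intro mult_left_mono norm_sgn_diff_remainder_le) (simp_all add: mult.assoc)
  also have "\<dots> \<le> C * (40 * (C * r) * (C * norm (y - z)) / (norm (\<Sigma> *v w))\<^sup>2)"
    using assms(1)[of "y - z"] assms(2) r
    by (intro mult_left_mono divide_right_mono)
      (auto simp: matrix_vector_mult_diff_distrib)
  finally show ?thesis by (simp add: power3_eq_cube algebra_simps)
qed

section \<open>Empirical loss sums and optimality conditions of the median\<close>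

definition loss_sum :: "real^'d^'d \<Rightarrow> nat \<Rightarrow> (nat \<Rightarrow> real^'d) \<Rightarrow> real^'d \<Rightarrow> real" where
  "loss_sum \<Sigma> V \<theta> z = (\<Sum>v=1..V. mnorm \<Sigma> (z - \<theta> v))"

definition grad_sum :: "real^'d^'d \<Rightarrow> nat \<Rightarrow> (nat \<Rightarrow> real^'d) \<Rightarrow> real^'d \<Rightarrow> real^'d" where
  "grad_sum \<Sigma> V \<theta> z = (\<Sum>v=1..V. mnorm_grad \<Sigma> (z - \<theta> v))"

lemma loss_sum_subgradient:
  assumes "pos_def_matrix \<Sigma>"
  shows "loss_sum \<Sigma> V \<theta> x + grad_sum \<Sigma> V \<theta> x \<bullet> (y - x) \<le> loss_sum \<Sigma> V \<theta> y"
proof -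
  have "mnorm \<Sigma> (x - \<theta> v) + mnorm_grad \<Sigma> (x - \<theta> v) \<bullet> (y - x) \<le> mnorm \<Sigma> (y - \<theta> v)" for v
    using mnorm_subgradient[OF assms, of "x - \<theta> v" "y - \<theta> v"] by simp
  then show ?thesis
    unfolding loss_sum_def grad_sum_def inner_sum_left sum.distrib[symmetric] by (intro sum_mono)
qed

lemma loss_sum_le_second_order:
  assumes "pos_def_matrix \<Sigma>" "\<And>v. v \<in> {1..V} \<Longrightarrow> x \<noteq> \<theta> v"
  shows "loss_sum \<Sigma> V \<theta> y \<le> loss_sum \<Sigma> V \<theta> x + grad_sum \<Sigma> V \<theta> x \<bullet> (y - x)
           + (norm (\<Sigma> *v (y - x)))\<^sup>2 * (\<Sum>v=1..V. 2 / norm (\<Sigma> *v (x - \<theta> v)))"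
proof -
  have "mnorm \<Sigma> (y - \<theta> v) \<le> mnorm \<Sigma> (x - \<theta> v) + mnorm_grad \<Sigma> (x - \<theta> v) \<bullet> (y - x)
      + (norm (\<Sigma> *v (y - x)))\<^sup>2 * (2 / norm (\<Sigma> *v (x - \<theta> v)))" if "v \<in> {1..V}" for v
    using mnorm_le_second_order[OF assms(1), of "x - \<theta> v" "y - \<theta> v"] assms(2)[OF that]
    by (simp add: mult.commute)
  then show ?thesis
    unfolding loss_sum_def grad_sum_def inner_sum_left sum_distrib_left sum.distrib[symmetric]
    by (intro sum_mono)
qed

lemma skewed_gm_minimal:
  assumes "is_skewed_gm \<Sigma> s V \<theta> x"
  shows "mnorm \<Sigma> (x - s) + loss_sum \<Sigma> V \<theta> x \<le> mnorm \<Sigma> (y - s) + loss_sum \<Sigma> V \<theta> y"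
proof -
  have "empirical_loss \<Sigma> s V \<theta> x \<le> empirical_loss \<Sigma> s V \<theta> y"
    using assms unfolding is_skewed_gm_def is_arg_min_linorder by simp
  then show ?thesis
    unfolding empirical_loss_def loss_sum_def by (rule mult_left_le_imp_le) simp
qed

lemma mnorm_scaleR: "mnorm \<Sigma> (c *\<^sub>R x) = \<bar>c\<bar> * mnorm \<Sigma> x"
  by (simp add: mnorm_def matrix_vector_mult_scaleR)

lemma mnorm_triangle: "mnorm \<Sigma> (x + y) \<le> mnorm \<Sigma> x + mnorm \<Sigma> y"
  by (simp add: mnorm_def matrix_vector_right_distrib norm_triangle_ineq)

text \<open>A step from \<open>x\<close> against \<open>u\<close> raises the distance to the vote by
  at most \<open>h * mnorm \<Sigma> u\<close>. Only the triangle inequality is used for that term,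
  so the case \<open>x = s\<close> is included; the voters, being away from \<open>x\<close>, are
  expanded to second order.\<close>

lemma skewed_gm_grad_upper:
  assumes "pos_def_matrix \<Sigma>" "is_skewed_gm \<Sigma> s V \<theta> x" "\<And>v. v \<in> {1..V} \<Longrightarrow> x \<noteq> \<theta> v"
  shows "grad_sum \<Sigma> V \<theta> x \<bullet> u \<le> mnorm \<Sigma> u"
proof (rule le_of_quadratic_perturbation)
  fix h :: real assume h: "0 < h" "h \<le> 1"
  let ?y = "x - h *\<^sub>R u"
  have "mnorm \<Sigma> (?y - s) \<le> mnorm \<Sigma> (x - s) + h * mnorm \<Sigma> u"
    using mnorm_triangle[of \<Sigma> "x - s" "(- h) *\<^sub>R u"] h
    by (simp add: mnorm_scaleR[of _ "- h", simplified] algebra_simps)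
  moreover have "mnorm \<Sigma> (x - s) + loss_sum \<Sigma> V \<theta> x \<le> mnorm \<Sigma> (?y - s) + loss_sum \<Sigma> V \<theta> ?y"
    by (rule skewed_gm_minimal[OF assms(2)])
  moreover have "loss_sum \<Sigma> V \<theta> ?y \<le> loss_sum \<Sigma> V \<theta> x + grad_sum \<Sigma> V \<theta> x \<bullet> (?y - x)
      + (norm (\<Sigma> *v (?y - x)))\<^sup>2 * (\<Sum>v=1..V. 2 / norm (\<Sigma> *v (x - \<theta> v)))"
    by (rule loss_sum_le_second_order[OF assms(1,3)])
  moreover have "norm (\<Sigma> *v (?y - x)) = h * norm (\<Sigma> *v u)"
    using mnorm_scaleR[of \<Sigma> "- h" u] h by (simp add: mnorm_def)
  ultimately show "h * (grad_sum \<Sigma> V \<theta> x \<bullet> u) \<le> h * mnorm \<Sigma> u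
      + h\<^sup>2 * ((norm (\<Sigma> *v u))\<^sup>2 * (\<Sum>v=1..V. 2 / norm (\<Sigma> *v (x - \<theta> v))))"
    by (simp add: power_mult_distrib mult.assoc)
qed

text \<open>A step straight towards \<open>t\<close> shrinks the distance to \<open>t\<close>
  exactly by the factor \<open>1 - h\<close>, so minimality forces the voters to resist with the
  full amount.\<close>

lemma skewed_gm_grad_lower:
  assumes "pos_def_matrix \<Sigma>" "is_skewed_gm \<Sigma> t V \<theta> x" "\<And>v. v \<in> {1..V} \<Longrightarrow> x \<noteq> \<theta> v"
  shows "mnorm \<Sigma> (t - x) \<le> grad_sum \<Sigma> V \<theta> x \<bullet> (t - x)"
proof (rule le_of_quadratic_perturbation)
  fix h :: real assume h: "0 < h" "h \<le> 1"
  let ?y = "x + h *\<^sub>R (t - x)"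
  have e: "?y - t = (h - 1) *\<^sub>R (t - x)" "x - t = (- 1) *\<^sub>R (t - x)" by (simp_all add: algebra_simps)
  have "mnorm \<Sigma> (?y - t) = (1 - h) * mnorm \<Sigma> (t - x)" "mnorm \<Sigma> (x - t) = mnorm \<Sigma> (t - x)"
    using h unfolding e mnorm_scaleR by auto
  moreover have "mnorm \<Sigma> (x - t) + loss_sum \<Sigma> V \<theta> x \<le> mnorm \<Sigma> (?y - t) + loss_sum \<Sigma> V \<theta> ?y"
    by (rule skewed_gm_minimal[OF assms(2)])
  moreover have "loss_sum \<Sigma> V \<theta> ?y \<le> loss_sum \<Sigma> V \<theta> x + grad_sum \<Sigma> V \<theta> x \<bullet> (?y - x)
      + (norm (\<Sigma> *v (?y - x)))\<^sup>2 * (\<Sum>v=1..V. 2 / norm (\<Sigma> *v (x - \<theta> v)))"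
    by (rule loss_sum_le_second_order[OF assms(1,3)])
  moreover have "norm (\<Sigma> *v (?y - x)) = h * norm (\<Sigma> *v (t - x))" "?y - x = h *\<^sub>R (t - x)"
    using mnorm_scaleR[of \<Sigma> h "t - x"] h by (simp_all add: mnorm_def)
  ultimately show "h * mnorm \<Sigma> (t - x) \<le> h * (grad_sum \<Sigma> V \<theta> x \<bullet> (t - x))
      + h\<^sup>2 * ((norm (\<Sigma> *v (t - x)))\<^sup>2 * (\<Sum>v=1..V. 2 / norm (\<Sigma> *v (x - \<theta> v))))"
    by (simp add: power_mult_distrib mult.assoc left_diff_distrib)
qed

text \<open>The deterministic core: whatever depends on the sample is a hypothesis at the fixed
  point \<open>g\<close>, free of \<open>t\<close> and \<open>s\<close>. Of the relative
  linearisation error \<eta>, the part with \<eta>1 pays for the remainders and \<eta>2 for the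
  deviation of the empirical Hessian.\<close>

lemma skewed_gm_near_strategyproof:
  fixes \<Sigma> S H :: "real^'d^'d" and g :: "real^'d"
  assumes \<Sigma>: "pos_def_matrix \<Sigma>" and S: "pos_def_matrix S" and H: "pos_def_matrix H"
    and C: "C > 0" "\<And>x. norm (\<Sigma> *v x) \<le> C * norm x"
    and \<kappa>: "\<kappa> > 0" "\<And>x. \<kappa> * (norm x)\<^sup>2 \<le> x \<bullet> (H *v x)"
    and L: "L > 0" "\<And>x. norm x \<le> L * norm (S *v x)"
    and M: "M > 0" "\<And>x. norm (S *v x) \<le> M * norm x"
    and r: "r > 0"
    and sep: "\<And>v. v \<in> {1..V} \<Longrightarrow> 2 * C * r < norm (\<Sigma> *v (g - \<theta> v))"
    and inv_sq: "r * (\<Sum>v=1..V. 1 / (norm (\<Sigma> *v (g - \<theta> v)))\<^sup>2) \<le> V * \<eta>1"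
    and hess: "\<And>u. norm ((\<Sum>v=1..V. mnorm_hess \<Sigma> (g - \<theta> v) u) - real V *\<^sub>R (H *v u)) \<le> V * \<eta>2 * norm u"
    and \<eta>: "\<eta> = 40 * C ^ 3 * \<eta>1 + \<eta>2" "0 \<le> \<eta>" "\<eta> \<le> \<kappa> / 2"
    and grad: "norm (grad_sum \<Sigma> V \<theta> g) + C < V * \<kappa> * r / 8"
    and gt: "is_skewed_gm \<Sigma> t V \<theta> gt" and gs: "is_skewed_gm \<Sigma> s V \<theta> gs"
  shows "(1 - \<eta> * (1 + L * M) / \<kappa>) * mnorm S (gt - t)
      \<le> (1 + Skew (matrix_inv S ** H ** matrix_inv S)) * mnorm S (gs - t)"
proof -
  let ?G = "grad_sum \<Sigma> V \<theta>"
  have V: "real V > 0"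
  proof (rule ccontr)
    assume "\<not> real V > 0"
    then have "V = 0" by simp
    then have "norm (?G g) + C < 0" using grad by simp
    then show False using C(1) norm_ge_zero[of "?G g"] by linarith
  qed
  \<comment> \<open>Each voter leaves a remainder of order r |x - z| divided by the squared distance
    to \<open>g\<close>, and \<open>inv_sq\<close> controls the sum; \<open>hess\<close> then
    exchanges the empirical Hessian for V H.\<close>
  have near: "norm (?G x - ?G z - real V *\<^sub>R (H *v (x - z))) \<le> V * \<eta> * norm (x - z)"
    if "norm (x - g) \<le> r" "norm (z - g) \<le> r" for x z
  proof -
    let ?h = "\<lambda>v. mnorm_hess \<Sigma> (g - \<theta> v) (x - z)"
    have *: "norm (mnorm_grad \<Sigma> (x - \<theta> v) - mnorm_grad \<Sigma> (z - \<theta> v) - ?h v)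
        \<le> 40 * C ^ 3 * r * norm (x - z) / (norm (\<Sigma> *v (g - \<theta> v)))\<^sup>2" if v: "v \<in> {1..V}" for v
    proof -
      have "0 < 2 * C * r" using C(1) r by simp
      then have "norm (\<Sigma> *v (g - \<theta> v)) > 0" using sep[OF v] by linarith
      then show ?thesis
        using norm_mnorm_grad_diff_remainder_le[of \<Sigma> C "g - \<theta> v" "x - \<theta> v" r "z - \<theta> v"]
          \<open>norm (x - g) \<le> r\<close> \<open>norm (z - g) \<le> r\<close> C sep[OF v] by simp
    qed
    have "norm (?G x - ?G z - (\<Sum>v=1..V. ?h v))
        = norm (\<Sum>v=1..V. mnorm_grad \<Sigma> (x - \<theta> v) - mnorm_grad \<Sigma> (z - \<theta> v) - ?h v)"
      by (simp add: grad_sum_def sum_subtractf)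
    also have "\<dots> \<le> (\<Sum>v=1..V. 40 * C ^ 3 * r * norm (x - z) / (norm (\<Sigma> *v (g - \<theta> v)))\<^sup>2)"
      by (rule sum_norm_le) (rule *)
    also have "\<dots> = 40 * C ^ 3 * norm (x - z) * (r * (\<Sum>v=1..V. 1 / (norm (\<Sigma> *v (g - \<theta> v)))\<^sup>2))"
      by (simp add: sum_distrib_left mult_ac)
    also have "\<dots> \<le> 40 * C ^ 3 * norm (x - z) * (V * \<eta>1)"
      using C by (intro mult_left_mono inv_sq) auto
    finally have 1: "norm (?G x - ?G z - (\<Sum>v=1..V. ?h v)) \<le> 40 * C ^ 3 * norm (x - z) * (V * \<eta>1)" .
    have "norm (?G x - ?G z - real V *\<^sub>R (H *v (x - z)))
        \<le> 40 * C ^ 3 * norm (x - z) * (V * \<eta>1) + V * \<eta>2 * norm (x - z)"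
      by (rule norm_diff_triangle_le[OF 1 hess])
    then show ?thesis by (simp add: \<eta>(1) algebra_simps)
  qed
  \<comment> \<open>Moving from \<open>g\<close> to \<open>x\<close> reduces the distance to the
    vote by at most \<open>C * norm (x - g)\<close>, however remote the vote is, so one radius
    serves all votes. The modulus V \<kappa> / 2 is what the error \<eta> \<le> \<kappa> / 2 leaves
    of V \<kappa>.\<close>
  have loc: "norm (x - g) \<le> r" if x: "is_skewed_gm \<Sigma> s' V \<theta> x" for s' x
  proof (rule convex_localisation[where F = "loss_sum \<Sigma> V \<theta>" and G = ?G
        and m = "V * (\<kappa> / 2)" and C = C])
    show "loss_sum \<Sigma> V \<theta> x + ?G x \<bullet> (y - x) \<le> loss_sum \<Sigma> V \<theta> y" for x y
      by (rule loss_sum_subgradient[OF \<Sigma>])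
    show "norm (?G g) + C < V * (\<kappa> / 2) * r / 4" using grad by simp
    show "V * (\<kappa> / 2) * (norm (y - g))\<^sup>2 \<le> (?G y - ?G g) \<bullet> (y - g)" if y: "norm (y - g) \<le> r" for y
    proof -
      let ?e = "?G y - ?G g - real V *\<^sub>R (H *v (y - g))"
      have "\<bar>?e \<bullet> (y - g)\<bar> \<le> norm ?e * norm (y - g)" by (rule Cauchy_Schwarz_ineq2)
      also have "\<dots> \<le> (V * \<eta> * norm (y - g)) * norm (y - g)"
        using near[of y g] y r by (intro mult_right_mono) auto
      also have "\<dots> \<le> (V * (\<kappa> / 2) * norm (y - g)) * norm (y - g)"
        using \<eta>(3) by (intro mult_right_mono mult_left_mono) auto
      finally have "- (V * (\<kappa> / 2) * (norm (y - g))\<^sup>2) \<le> ?e \<bullet> (y - g)"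
        unfolding power2_eq_square mult.assoc[symmetric] by linarith
      moreover have "?e \<bullet> (y - g) = (?G y - ?G g) \<bullet> (y - g) - V * ((y - g) \<bullet> (H *v (y - g)))"
        by (simp only: inner_diff_left[of "?G y - ?G g"] inner_scaleR_left inner_commute[of "H *v _"])
      moreover have "V * (\<kappa> * (norm (y - g))\<^sup>2) \<le> V * ((y - g) \<bullet> (H *v (y - g)))"
        by (intro mult_left_mono \<kappa>) simp
      moreover have "V * (\<kappa> * (norm (y - g))\<^sup>2)
          = V * (\<kappa> / 2) * (norm (y - g))\<^sup>2 + V * (\<kappa> / 2) * (norm (y - g))\<^sup>2" by simp
      ultimately show ?thesis by linarith
    qed
    have "loss_sum \<Sigma> V \<theta> x - loss_sum \<Sigma> V \<theta> g \<le> mnorm \<Sigma> (g - s') - mnorm \<Sigma> (x - s')"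
      using skewed_gm_minimal[OF x, of g] by simp
    also have "\<dots> \<le> mnorm \<Sigma> (g - x)"
      using mnorm_triangle[of \<Sigma> "g - x" "x - s'"] by simp
    also have "\<dots> \<le> C * norm (x - g)"
      using C(2)[of "g - x"] by (simp add: mnorm_def norm_minus_commute)
    finally show "loss_sum \<Sigma> V \<theta> x - loss_sum \<Sigma> V \<theta> g \<le> C * norm (x - g)" .
  qed (rule r)
  have sepx: "x \<noteq> \<theta> v" if "norm (x - g) \<le> r" "v \<in> {1..V}" for x v
  proof
    assume "x = \<theta> v"
    then have "norm (\<Sigma> *v (g - \<theta> v)) \<le> C * norm (x - g)"
      using C(2)[of "g - x"] by (simp add: norm_minus_commute)
    also have "\<dots> \<le> C * r" using C(1) that(1) by simp
    also have "\<dots> < 2 * C * r" using C(1) r by simp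
    finally show False using sep[OF that(2)] by simp
  qed
  define x z w where "x = gt" and "z = gs" and "w = t - gt"
  have xz: "norm (x - g) \<le> r" "norm (z - g) \<le> r"
    using loc[OF gt] loc[OF gs] by (auto simp: x_def z_def)
  have SI: "pos_def_matrix (matrix_inv S ** H ** matrix_inv S)"
    by (rule pos_def_conjugate[OF H S])
  define \<alpha> where "\<alpha> = Skew (matrix_inv S ** H ** matrix_inv S)"
  have \<alpha>: "0 \<le> \<alpha>" unfolding \<alpha>_def by (rule Skew_nonneg[OF SI])
  show ?thesis
  \<comment> \<open>If the honest outcome is at least as close to \<open>t\<close>, the claim is
    immediate from \<alpha> \<ge> 0. Otherwise \<open>t - z\<close>, and with it
    \<open>z - x\<close>, is bounded by a multiple of \<open>w\<close>, so the linearisation error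
    is small against the quadratic form at \<open>w\<close> even if \<open>w\<close> is
    tiny.\<close>
  proof (cases "mnorm S w \<le> mnorm S (t - z)")
    case True
    then have le: "mnorm S (gt - t) \<le> mnorm S (gs - t)"
      by (auto simp: w_def z_def mnorm_def matrix_vector_mult_diff_distrib norm_minus_commute)
    have "(1 - \<eta> * (1 + L * M) / \<kappa>) * mnorm S (gt - t) \<le> 1 * mnorm S (gt - t)"
      using L(1) M(1) \<kappa>(1) \<eta>(2) by (intro mult_right_mono) (auto simp: mnorm_def)
    also have "\<dots> \<le> 1 * mnorm S (gs - t)" using le by simp
    also have "\<dots> \<le> (1 + \<alpha>) * mnorm S (gs - t)"
      using \<alpha> by (intro mult_right_mono) (auto simp: mnorm_def)
    finally show ?thesis unfolding \<alpha>_def .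
  next
    case False
    then have lt: "mnorm S (t - z) < mnorm S w" by simp
    have w: "norm w > 0" using lt by (auto simp: mnorm_def)
    have "norm (z - x) \<le> norm w + norm (t - z)"
      using norm_triangle_ineq4[of w "t - z"] by (simp add: w_def x_def)
    also have "norm (t - z) \<le> L * mnorm S w"
      using L(2)[of "t - z"] lt L(1) by (smt (verit) mnorm_def mult_left_mono)
    also have "L * mnorm S w \<le> L * (M * norm w)"
      using M(2)[of w] L(1) by (intro mult_left_mono) (auto simp: mnorm_def)
    finally have zx: "norm (z - x) \<le> (1 + L * M) * norm w" by (simp add: algebra_simps)
    let ?e = "?G z - ?G x - real V *\<^sub>R (H *v (z - x))"
    \<comment> \<open>Both optimality conditions are tested in the direction \<open>w\<close>:
      \<open>mnorm \<Sigma> w\<close> cancels, and the strategic vote \<open>s\<close> disappears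
      from the argument.\<close>
    have "?G z \<bullet> w \<le> mnorm \<Sigma> w"
      unfolding z_def by (rule skewed_gm_grad_upper[OF \<Sigma> gs]) (use sepx xz in \<open>auto simp: z_def\<close>)
    moreover have "mnorm \<Sigma> w \<le> ?G x \<bullet> w"
      unfolding x_def w_def by (rule skewed_gm_grad_lower[OF \<Sigma> gt]) (use sepx xz in \<open>auto simp: x_def\<close>)
    moreover have "?e \<bullet> w = ?G z \<bullet> w - ?G x \<bullet> w - V * ((H *v (z - x)) \<bullet> w)"
      by (simp only: inner_diff_left[of "?G z - ?G x"] inner_diff_left[of "?G z"] inner_scaleR_left)
    ultimately have "V * ((H *v (z - x)) \<bullet> w) \<le> - (?e \<bullet> w)" by linarith
    also have "\<dots> \<le> norm ?e * norm w" using Cauchy_Schwarz_ineq2[of ?e w] by linarith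
    also have "\<dots> \<le> (V * \<eta> * norm (z - x)) * norm w"
      by (intro mult_right_mono near xz) simp
    also have "\<dots> \<le> (V * \<eta> * ((1 + L * M) * norm w)) * norm w"
      using zx \<eta>(2) by (intro mult_right_mono mult_left_mono) auto
    also have "\<dots> = V * (\<eta> * (1 + L * M) * (norm w)\<^sup>2)" by (simp add: power2_eq_square)
    finally have "(H *v (z - x)) \<bullet> w \<le> \<eta> * (1 + L * M) * (norm w)\<^sup>2" using V by simp
    also have "\<dots> = \<eta> * (1 + L * M) / \<kappa> * (\<kappa> * (norm w)\<^sup>2)" using \<kappa>(1) by simp
    also have "\<dots> \<le> \<eta> * (1 + L * M) / \<kappa> * (w \<bullet> (H *v w))"
      using L(1) M(1) \<kappa> \<eta>(2) by (intro mult_left_mono) auto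
    finally have 1: "(H *v (z - x)) \<bullet> w \<le> \<eta> * (1 + L * M) / \<kappa> * (w \<bullet> (H *v w))" .
    have "t - z = w - (z - x)" by (simp add: w_def x_def)
    then have "(H *v w) \<bullet> (t - z) = (H *v w) \<bullet> w - (H *v w) \<bullet> (z - x)"
      by (simp only: inner_diff_right)
    then have "(H *v w) \<bullet> (t - z) = w \<bullet> (H *v w) - (H *v (z - x)) \<bullet> w"
      using pos_def_inner_commute[OF H, of "z - x" w] by (simp only: inner_commute)
    with 1 have 2: "(1 - \<eta> * (1 + L * M) / \<kappa>) * (w \<bullet> (H *v w)) \<le> (H *v w) \<bullet> (t - z)"
      by (simp add: algebra_simps)
    note SI' = pos_def_matrix_inv[OF S]
    \<comment> \<open>In this coordinate the form of \<open>H\<close> at \<open>w\<close> becomes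
      the form of the conjugated matrix at \<open>y\<close>, and \<open>S\<close> absorbs the
      distance to \<open>z\<close>. Multiplying by \<open>norm y\<close> then produces the numerator
      of the skewness quotient, and the positive form cancels from both sides.\<close>
    define y where "y = S *v w"
    have y: "matrix_inv S *v y = w" by (simp add: y_def matrix_vector_mul_assoc SI')
    have A: "(matrix_inv S ** H ** matrix_inv S) *v y = matrix_inv S *v (H *v w)"
      by (metis y matrix_vector_mul_assoc)
    have tr: "(matrix_inv S *v a) \<bullet> b = a \<bullet> (matrix_inv S *v b)" for a b
      by (metis SI'(3) dot_lmul_matrix transpose_matrix_vector)
    have Ay: "y \<bullet> ((matrix_inv S ** H ** matrix_inv S) *v y) = w \<bullet> (H *v w)"
      unfolding A by (metis tr y)
    have "(H *v w) \<bullet> (t - z) = (matrix_inv S *v (H *v w)) \<bullet> (S *v (t - z))"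
      unfolding tr by (simp add: matrix_vector_mul_assoc SI')
    also have "\<dots> \<le> norm (matrix_inv S *v (H *v w)) * mnorm S (t - z)"
      unfolding mnorm_def by (rule norm_cauchy_schwarz)
    finally have 3: "(H *v w) \<bullet> (t - z) \<le> norm (matrix_inv S *v (H *v w)) * mnorm S (t - z)" .
    have "norm y * ((1 - \<eta> * (1 + L * M) / \<kappa>) * (w \<bullet> (H *v w)))
        \<le> norm y * (norm (matrix_inv S *v (H *v w)) * mnorm S (t - z))"
      using 2 3 by (intro mult_left_mono) auto
    also have "\<dots> = (norm y * norm ((matrix_inv S ** H ** matrix_inv S) *v y)) * mnorm S (t - z)"
      unfolding A by simp
    also have "\<dots> \<le> ((1 + \<alpha>) * (w \<bullet> (H *v w))) * mnorm S (t - z)"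
      using Skew_bound[OF SI, of y] unfolding Ay \<alpha>_def by (intro mult_right_mono) (auto simp: mnorm_def)
    finally have "(w \<bullet> (H *v w)) * ((1 - \<eta> * (1 + L * M) / \<kappa>) * norm y)
        \<le> (w \<bullet> (H *v w)) * ((1 + \<alpha>) * mnorm S (t - z))" by (simp add: mult_ac)
    moreover have "w \<bullet> (H *v w) > 0" using H w by (simp add: pos_def_matrix_def)
    ultimately have "(1 - \<eta> * (1 + L * M) / \<kappa>) * norm y \<le> (1 + \<alpha>) * mnorm S (t - z)"
      by (rule mult_left_le_imp_le)
    moreover have "norm y = mnorm S (gt - t)" "mnorm S (t - z) = mnorm S (gs - t)"
      by (auto simp: y_def w_def z_def mnorm_def matrix_vector_mult_diff_distrib norm_minus_commute)
    ultimately show ?thesis by (simp add: \<alpha>_def)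
  qed
qed

section \<open>Sums of independent samples\<close>

lemma integral_PiM_component:
  fixes f :: "'a \<Rightarrow> 'b::{banach, second_countable_topology}"
  assumes D: "prob_space D" and v: "v \<in> I" and f: "f \<in> borel_measurable D"
  shows "integrable (Pi\<^sub>M I (\<lambda>_. D)) (\<lambda>\<omega>. f (\<omega> v)) \<longleftrightarrow> integrable D f"
    and "(LINT \<omega>|Pi\<^sub>M I (\<lambda>_. D). f (\<omega> v)) = (LINT x|D. f x)"
proof -
  have eq: "distr (Pi\<^sub>M I (\<lambda>_. D)) D (\<lambda>\<omega>. \<omega> v) = D"
    using distr_PiM_component[of I "\<lambda>_. D" v] D v by simp
  have m: "(\<lambda>\<omega>. \<omega> v) \<in> Pi\<^sub>M I (\<lambda>_. D) \<rightarrow>\<^sub>M D" using v by simp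
  show "integrable (Pi\<^sub>M I (\<lambda>_. D)) (\<lambda>\<omega>. f (\<omega> v)) \<longleftrightarrow> integrable D f"
    using integrable_distr_eq[OF m f] by (simp add: eq)
  show "(LINT \<omega>|Pi\<^sub>M I (\<lambda>_. D). f (\<omega> v)) = (LINT x|D. f x)"
    using integral_distr[OF m f] by (simp add: eq)
qed

lemma integral_PiM_mult_components:
  fixes f :: "'a \<Rightarrow> real"
  assumes D: "prob_space D" and I: "finite I" "v \<in> I" "w \<in> I" "v \<noteq> w" and f: "integrable D f"
  shows "integrable (Pi\<^sub>M I (\<lambda>_. D)) (\<lambda>\<omega>. f (\<omega> v) * f (\<omega> w))"
    and "(LINT \<omega>|Pi\<^sub>M I (\<lambda>_. D). f (\<omega> v) * f (\<omega> w)) = (LINT x|D. f x) * (LINT x|D. f x)"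
proof -
  interpret D: prob_space D by (rule D)
  interpret product_prob_space "\<lambda>_. D" ..
  \<comment> \<open>Padding with the constant 1 turns the two-factor product into a product over all
    of \<open>I\<close>, to which Fubini for finite products applies.\<close>
  define h where "h i x = (if i \<in> {v, w} then f x else 1)" for i x
  have int: "integrable D (h i)" for i
    by (cases "i \<in> {v, w}") (use f in \<open>simp_all add: h_def[abs_def]\<close>)
  have sub: "{v, w} \<subseteq> I" using I by auto
  have h: "(\<Prod>i\<in>I. h i (\<omega> i)) = f (\<omega> v) * f (\<omega> w)" for \<omega>
    using prod.mono_neutral_right[OF I(1) sub, of "\<lambda>i. h i (\<omega> i)"] I(4) by (simp add: h_def)
  have e: "(\<Prod>i\<in>I. LINT x|D. h i x) = (LINT x|D. f x) * (LINT x|D. f x)"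
    using prod.mono_neutral_right[OF I(1) sub, of "\<lambda>i. LINT x|D. h i x"] I(4)
    by (simp add: h_def D.prob_space)
  show "integrable (Pi\<^sub>M I (\<lambda>_. D)) (\<lambda>\<omega>. f (\<omega> v) * f (\<omega> w))"
    using product_integrable_prod[OF I(1), of h, OF int] unfolding h .
  show "(LINT \<omega>|Pi\<^sub>M I (\<lambda>_. D). f (\<omega> v) * f (\<omega> w)) = (LINT x|D. f x) * (LINT x|D. f x)"
    using product_integral_prod[OF I(1), of h, OF int] unfolding h e .
qed

text \<open>Chebyshev's inequality: after centring, independence removes the cross terms, and the
  second moment of the sum is V times the variance.\<close>

lemma prob_sum_deviation_le:
  fixes f :: "'a \<Rightarrow> real" and V :: nat
  assumes D: "prob_space D" and f[measurable]: "f \<in> borel_measurable D"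
    and sq: "integrable D (\<lambda>x. (f x)\<^sup>2)" and a: "a > 0"
  shows "measure (Pi\<^sub>M {1..V} (\<lambda>_. D))
      {\<omega> \<in> space (Pi\<^sub>M {1..V} (\<lambda>_. D)). a \<le> \<bar>(\<Sum>v=1..V. f (\<omega> v)) - V * (LINT x|D. f x)\<bar>}
    \<le> V * (LINT x|D. (f x - (LINT x|D. f x))\<^sup>2) / a\<^sup>2"
proof -
  interpret D: prob_space D by (rule D)
  let ?M = "Pi\<^sub>M {1..V} (\<lambda>_. D)" and ?m = "LINT x|D. f x"
  interpret M: prob_space ?M by (rule prob_space_PiM) (rule D)
  have intf: "integrable D f" by (rule D.square_integrable_imp_integrable[OF f sq])
  define c where "c x = f x - ?m" for x
  have c[measurable]: "c \<in> borel_measurable D" unfolding c_def by simp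
  have intc: "integrable D c" unfolding c_def using intf by simp
  have c0: "(LINT x|D. c x) = 0" unfolding c_def using intf by (simp add: D.prob_space)
  have sqc: "integrable D (\<lambda>x. (c x)\<^sup>2)"
    unfolding c_def power2_diff using intf sq by simp
  have S: "(\<Sum>v=1..V. f (\<omega> v)) - V * ?m = (\<Sum>v=1..V. c (\<omega> v))" for \<omega>
    by (simp add: c_def sum_subtractf)
  have cross: "integrable ?M (\<lambda>\<omega>. c (\<omega> v) * c (\<omega> w))
      \<and> (LINT \<omega>|?M. c (\<omega> v) * c (\<omega> w)) = (if v = w then LINT x|D. (c x)\<^sup>2 else 0)"
    if "v \<in> {1..V}" "w \<in> {1..V}" for v w
  proof (cases "v = w")
    case True
    then show ?thesis
      using integral_PiM_component[OF D that(1), of "\<lambda>x. (c x)\<^sup>2"] sqc by (simp add: power2_eq_square)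
  next
    case False
    then show ?thesis
      using integral_PiM_mult_components[OF D _ that False intc] c0 by simp
  qed
  have sqS: "(\<Sum>v=1..V. c (\<omega> v))\<^sup>2 = (\<Sum>v=1..V. \<Sum>w=1..V. c (\<omega> v) * c (\<omega> w))" for \<omega>
    by (simp add: power2_eq_square sum_product)
  have int: "integrable ?M (\<lambda>\<omega>. (\<Sum>v=1..V. c (\<omega> v))\<^sup>2)"
    unfolding sqS by (intro Bochner_Integration.integrable_sum) (use cross in blast)
  have "(LINT \<omega>|?M. (\<Sum>v=1..V. c (\<omega> v))\<^sup>2)
      = (\<Sum>v=1..V. \<Sum>w=1..V. LINT \<omega>|?M. c (\<omega> v) * c (\<omega> w))"
    unfolding sqS using cross
    by (subst Bochner_Integration.integral_sum; (intro Bochner_Integration.integrable_sum)?)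
      (auto intro!: sum.cong)
  also have "\<dots> = (\<Sum>v=1..V. \<Sum>w=1..V. if v = w then LINT x|D. (c x)\<^sup>2 else 0)"
    using cross by (intro sum.cong) auto
  also have "\<dots> = V * (LINT x|D. (c x)\<^sup>2)" by simp
  finally have E: "(LINT \<omega>|?M. (\<Sum>v=1..V. c (\<omega> v))\<^sup>2) = V * (LINT x|D. (c x)\<^sup>2)" .
  have "{\<omega> \<in> space ?M. a \<le> \<bar>\<Sum>v=1..V. c (\<omega> v)\<bar>} = {\<omega> \<in> space ?M. a\<^sup>2 \<le> (\<Sum>v=1..V. c (\<omega> v))\<^sup>2}"
    using a by (auto simp: abs_le_square_iff[symmetric])
  moreover have "measure ?M {\<omega> \<in> space ?M. a\<^sup>2 \<le> (\<Sum>v=1..V. c (\<omega> v))\<^sup>2}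
      \<le> (LINT \<omega>|?M. (\<Sum>v=1..V. c (\<omega> v))\<^sup>2) / a\<^sup>2"
    by (rule integral_Markov_inequality_measure[OF int, where A = "space ?M - space ?M"]) (use a in auto)
  ultimately show ?thesis unfolding S E by (simp add: c_def)
qed

text \<open>The threshold is of order V^(3/4), beyond the standard deviation of order V^(1/2), so
  Chebyshev's bound is O(V^(-1/2)).\<close>

lemma prob_sum_deviation_tendsto_0:
  fixes f :: "'a \<Rightarrow> real"
  assumes D: "prob_space D" and f: "f \<in> borel_measurable D"
    and sq: "integrable D (\<lambda>x. (f x)\<^sup>2)" and c: "c > 0"
  shows "(\<lambda>V. measure (Pi\<^sub>M {1..V} (\<lambda>_. D))
      {\<omega> \<in> space (Pi\<^sub>M {1..V} (\<lambda>_. D)).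
        c * (real V * real V powr (-1/4)) \<le> \<bar>(\<Sum>v=1..V. f (\<omega> v)) - V * (LINT x|D. f x)\<bar>})
    \<longlonglongrightarrow> 0"
proof (rule tendsto_sandwich[OF _ _ tendsto_const])
  define s where "s = (LINT x|D. (f x - (LINT x|D. f x))\<^sup>2)"
  show "(\<lambda>V. real V * s / (c * (real V * real V powr (-1/4)))\<^sup>2) \<longlonglongrightarrow> 0"
    using c by real_asymp
  show "\<forall>\<^sub>F V in sequentially. measure (Pi\<^sub>M {1..V} (\<lambda>_. D))
      {\<omega> \<in> space (Pi\<^sub>M {1..V} (\<lambda>_. D)).
        c * (real V * real V powr (-1/4)) \<le> \<bar>(\<Sum>v=1..V. f (\<omega> v)) - V * (LINT x|D. f x)\<bar>}
      \<le> real V * s / (c * (real V * real V powr (-1/4)))\<^sup>2"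
    using eventually_gt_at_top[of 0]
  proof eventually_elim
    case (elim V)
    then show ?case unfolding s_def using c by (intro prob_sum_deviation_le D f sq) auto
  qed
qed simp

text \<open>For a nonnegative function of which only a first moment is at hand. The prefactor
  V^(-1/4) already provides the decay in Markov's inequality.\<close>

lemma prob_sum_Markov_tendsto_0:
  fixes f :: "'a \<Rightarrow> real"
  assumes D: "prob_space D" and f: "integrable D f" "\<And>x. 0 \<le> f x" and c: "c > 0"
  shows "(\<lambda>V. measure (Pi\<^sub>M {1..V} (\<lambda>_. D))
      {\<omega> \<in> space (Pi\<^sub>M {1..V} (\<lambda>_. D)). c * real V \<le> real V powr (-1/4) * (\<Sum>v=1..V. f (\<omega> v))})
    \<longlonglongrightarrow> 0"
proof (rule tendsto_sandwich[OF _ _ tendsto_const])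
  define s where "s = (LINT x|D. f x)"
  have [measurable]: "f \<in> borel_measurable D" using f by simp
  show "(\<lambda>V. (real V powr (-1/4) * (real V * s)) / (c * real V)) \<longlonglongrightarrow> 0"
    using c by real_asymp
  show "\<forall>\<^sub>F V in sequentially. measure (Pi\<^sub>M {1..V} (\<lambda>_. D))
      {\<omega> \<in> space (Pi\<^sub>M {1..V} (\<lambda>_. D)). c * real V \<le> real V powr (-1/4) * (\<Sum>v=1..V. f (\<omega> v))}
      \<le> (real V powr (-1/4) * (real V * s)) / (c * real V)"
    using eventually_gt_at_top[of 0]
  proof eventually_elim
    case (elim V)
    let ?M = "Pi\<^sub>M {1..V} (\<lambda>_. D)"
    have 1: "integrable ?M (\<lambda>\<omega>. f (\<omega> v)) \<and> (LINT \<omega>|?M. f (\<omega> v)) = s" if "v \<in> {1..V}" for v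
      using integral_PiM_component[OF D that, of f] f(1) by (simp add: s_def)
    have int: "integrable ?M (\<lambda>\<omega>. real V powr (-1/4) * (\<Sum>v=1..V. f (\<omega> v)))"
      using 1 by (intro integrable_mult_right Bochner_Integration.integrable_sum) auto
    have "(LINT \<omega>|?M. real V powr (-1/4) * (\<Sum>v=1..V. f (\<omega> v))) = real V powr (-1/4) * (real V * s)"
      using 1 by (simp add: Bochner_Integration.integral_sum)
    then show ?case
      using integral_Markov_inequality_measure[OF int, where A = "space ?M - space ?M" and c = "c * real V"]
        c elim f(2) by (simp add: sum_nonneg)
  qed
qed simp

lemma prob_some_component_le:
  fixes V :: nat
  assumes D: "prob_space D" and B: "B \<in> sets D"
  shows "measure (Pi\<^sub>M {1..V} (\<lambda>_. D)) {\<omega> \<in> space (Pi\<^sub>M {1..V} (\<lambda>_. D)). \<exists>v\<in>{1..V}. \<omega> v \<in> B}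
    \<le> V * measure D B"
proof -
  let ?M = "Pi\<^sub>M {1..V} (\<lambda>_. D)"
  interpret D: prob_space D by (rule D)
  interpret M: prob_space ?M by (rule prob_space_PiM) (rule D)
  have m: "(\<lambda>\<omega>. \<omega> v) \<in> ?M \<rightarrow>\<^sub>M D" if "v \<in> {1..V}" for v using that by simp
  have A: "{\<omega> \<in> space ?M. \<omega> v \<in> B} \<in> sets ?M" if "v \<in> {1..V}" for v
    using measurable_sets[OF m[OF that] B] by (simp add: vimage_def Int_def conj_commute)
  have p: "measure ?M {\<omega> \<in> space ?M. \<omega> v \<in> B} = measure D B" if "v \<in> {1..V}" for v
  proof -
    have "measure (distr ?M D (\<lambda>\<omega>. \<omega> v)) B = measure ?M {\<omega> \<in> space ?M. \<omega> v \<in> B}"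
      unfolding measure_distr[OF m[OF that] B]
      by (rule arg_cong[where f = "measure ?M"]) (simp add: vimage_def Int_def conj_commute)
    then show ?thesis using distr_PiM_component[of "{1..V}" "\<lambda>_. D" v] D that by simp
  qed
  have "{\<omega> \<in> space ?M. \<exists>v\<in>{1..V}. \<omega> v \<in> B} = (\<Union>v\<in>{1..V}. {\<omega> \<in> space ?M. \<omega> v \<in> B})" by auto
  also have "measure ?M \<dots> \<le> (\<Sum>v\<in>{1..V}. measure ?M {\<omega> \<in> space ?M. \<omega> v \<in> B})"
    by (rule M.finite_measure_subadditive_finite) (use A in auto)
  also have "\<dots> = V * measure D B" using p by simp
  finally show ?thesis .
qed

section \<open>Integrability of inverse squared distances\<close>

text \<open>Dyadic decomposition around \<open>g\<close>: on the shell with outer radius 2^(-k) the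
  integrand is below 4^(k+1), while the ball has probability at most K 32^(-k), so the terms are
  dominated by the geometric series of 4 K 8^(-k).\<close>

lemma integrable_inverse_square_dist:
  fixes g :: "'a::euclidean_space"
  assumes D: "prob_space D" and sets: "sets D = sets borel"
    and small: "\<And>r. 0 < r \<Longrightarrow> measure D (cball g r) \<le> K * r ^ 5"
  shows "integrable D (\<lambda>\<theta>. 1 / (norm (g - \<theta>))\<^sup>2)"
proof -
  interpret D: prob_space D by (rule D)
  have K: "0 \<le> K" using order_trans[OF measure_nonneg small[of 1]] by simp
  define B where "B k = cball g ((1/2) ^ k)" for k :: nat
  have B[measurable]: "B k \<in> sets D" for k by (simp add: B_def sets)
  have [measurable]: "(\<lambda>\<theta>. 1 / (norm (g - \<theta>))\<^sup>2) \<in> borel_measurable D"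
    using sets by (simp cong: measurable_cong_sets)
  \<comment> \<open>The summand 1 covers points at distance above 1 and also
    \<open>\<theta> = g\<close>, where the quotient is 0 by convention.\<close>
  have point: "ennreal (1 / (norm (g - \<theta>))\<^sup>2)
      \<le> 1 + (\<Sum>k. ennreal (4 ^ (k + 1)) * indicator (B k) \<theta>)" for \<theta>
  proof (cases "\<theta> = g \<or> norm (g - \<theta>) > 1")
    case True
    then have "1 / (norm (g - \<theta>))\<^sup>2 \<le> 1"
      by (auto simp: divide_le_eq_1 one_le_power)
    then have "ennreal (1 / (norm (g - \<theta>))\<^sup>2) \<le> 1 + 0" by simp
    also have "\<dots> \<le> 1 + (\<Sum>k. ennreal (4 ^ (k + 1)) * indicator (B k) \<theta>)"
      by (intro add_left_mono) simp
    finally show ?thesis .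
  next
    case False
    define n where "n = norm (g - \<theta>)"
    have n: "0 < n" "n \<le> 1" using False by (auto simp: n_def)
    \<comment> \<open>The first dyadic radius below \<open>n\<close> is not 2^0 as
      \<open>n \<le> 1\<close>, so its index is a successor \<open>Suc k\<close>, and
      \<open>n\<close> lies in the shell between 2^(-k-1) and 2^(-k).\<close>
    define P where "P k \<longleftrightarrow> (1/2) ^ k < n" for k :: nat
    obtain k0 where "P k0" unfolding P_def using real_arch_pow_inv[OF n(1), of "1/2"] by auto
    then have P: "P (LEAST k. P k)" by (rule LeastI)
    have "\<not> P 0" using n by (simp add: P_def)
    with P obtain k where k: "(LEAST k. P k) = Suc k" by (metis not0_implies_Suc)
    then have "\<not> P k" by (metis lessI not_less_Least)
    with P k have nk: "n \<le> (1/2) ^ k" "(1/2) ^ Suc k < n" by (auto simp: P_def)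
    have "((1/2) ^ Suc k)\<^sup>2 \<le> n\<^sup>2" using nk by (intro power_mono) auto
    moreover have "((1/2::real) ^ Suc k)\<^sup>2 * 4 ^ (k + 1) = 1"
      by (simp add: power2_eq_square power_mult_distrib[symmetric])
    ultimately have "1 / n\<^sup>2 \<le> 4 ^ (k + 1)"
      using n(1) mult_right_mono[of "((1/2) ^ Suc k)\<^sup>2" "n\<^sup>2" "4 ^ (k + 1)"]
      by (simp add: divide_le_eq mult.commute)
    moreover have "\<theta> \<in> B k" using nk by (simp add: B_def n_def dist_norm)
    ultimately have "ennreal (1 / n\<^sup>2) \<le> ennreal (4 ^ (k + 1)) * indicator (B k) \<theta>"
      by (simp add: ennreal_leI)
    also have "\<dots> = (\<Sum>j\<in>{k}. ennreal (4 ^ (j + 1)) * indicator (B j) \<theta>)"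
      by (simp only: sum.insert finite.emptyI empty_iff not_False_eq_True sum.empty add_0_right)
    also have "\<dots> \<le> (\<Sum>k. ennreal (4 ^ (k + 1)) * indicator (B k) \<theta>)"
      by (intro sum_le_suminf) auto
    also have "\<dots> \<le> 1 + (\<Sum>k. ennreal (4 ^ (k + 1)) * indicator (B k) \<theta>)" by simp
    finally show ?thesis by (simp add: n_def)
  qed
  have "(\<integral>\<^sup>+\<theta>. ennreal (1 / (norm (g - \<theta>))\<^sup>2) \<partial>D)
      \<le> (\<integral>\<^sup>+\<theta>. 1 + (\<Sum>k. ennreal (4 ^ (k + 1)) * indicator (B k) \<theta>) \<partial>D)"
    by (intro nn_integral_mono point)
  also have "\<dots> = 1 + (\<Sum>k. ennreal (4 ^ (k + 1)) * emeasure D (B k))"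
    by (simp add: nn_integral_add nn_integral_suminf nn_integral_cmult D.emeasure_space_1)
  also have "\<dots> \<le> 1 + (\<Sum>k. ennreal (4 * K * (1/8) ^ k))"
  proof (intro add_left_mono suminf_le)
    show "ennreal (4 ^ (k + 1)) * emeasure D (B k) \<le> ennreal (4 * K * (1/8) ^ k)" for k
    proof -
      have "4 ^ (k + 1) * measure D (B k) \<le> 4 ^ (k + 1) * (K * ((1/2) ^ k) ^ 5)"
        unfolding B_def by (intro mult_left_mono small) auto
      also have "((1/2::real) ^ k) ^ 5 = ((1/2) ^ 5) ^ k"
        by (simp only: power_mult[symmetric] mult.commute)
      also have "4 ^ (k + 1) * (K * ((1/2) ^ 5) ^ k) = 4 * K * (4 * (1/2) ^ 5) ^ k"
        unfolding power_mult_distrib[of 4] by simp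
      also have "4 * (1/2) ^ 5 = (1/8::real)" by (simp add: power_divide)
      finally show ?thesis
        by (simp add: D.emeasure_eq_measure ennreal_mult'[symmetric] ennreal_leI)
    qed
  qed auto
  also have "(\<Sum>k. ennreal (4 * K * (1/8) ^ k)) = ennreal (\<Sum>k. 4 * K * (1/8) ^ k)"
    using K by (intro suminf_ennreal2 summable_mult) (auto intro: summable_geometric)
  also have "1 + ennreal (\<Sum>k. 4 * K * (1/8) ^ k) < \<infinity>" by simp
  finally show ?thesis
    by (intro integrableI_bounded) (simp_all add: ennreal_power[symmetric])
qed

text \<open>Two regimes make the bound valid for all \<open>r\<close>. Up to \<rho> the density is
  below |p g| + 1, the volume is of order r^DIM, and r \<le> 1 lowers the exponent to 5. Beyond
  \<rho> the trivial bound 1 is at most (r / \<rho>)^5.\<close>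

lemma density_small_ball:
  fixes g :: "'a::euclidean_space"
  assumes dim: "DIM('a) \<ge> 5" and D: "prob_space D" "D = density lborel (\<lambda>x. ennreal (p x))"
    and p: "p \<in> borel_measurable borel" "isCont p g"
  obtains K where "\<And>r. 0 < r \<Longrightarrow> measure D (cball g r) \<le> K * r ^ 5"
proof -
  interpret D: prob_space D by (rule D)
  obtain d where d: "d > 0" "\<And>x. dist x g < d \<Longrightarrow> dist (p x) (p g) < 1"
    using p(2) unfolding continuous_at_eps_delta by (metis zero_less_one)
  define b where "b = \<bar>p g\<bar> + 1"
  define c where "c = measure lborel (ball (0::'a) 1)"
  define \<rho> where "\<rho> = min 1 (d / 2)"
  have \<rho>: "0 < \<rho>" "\<rho> \<le> 1" "\<rho> < d" using d(1) by (auto simp: \<rho>_def)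
  have bc: "0 \<le> b" "0 \<le> c" by (auto simp: b_def c_def)
  show ?thesis
  proof (rule that)
    fix r :: real assume r: "0 < r"
    show "measure D (cball g r) \<le> (b * 2 ^ DIM('a) * c + 1 / \<rho> ^ 5) * r ^ 5"
    proof (cases "r \<le> \<rho>")
      case True
      have pb: "p x \<le> b" if "x \<in> cball g r" for x
      proof -
        have "dist x g < d" using that True \<rho> by (simp add: dist_commute)
        from d(2)[OF this] show ?thesis by (simp add: b_def dist_real_def)
      qed
      have "emeasure D (cball g r) = (\<integral>\<^sup>+x. ennreal (p x) * indicator (cball g r) x \<partial>lborel)"
        unfolding D(2) using p(1) by (subst emeasure_density) auto
      also have "\<dots> \<le> (\<integral>\<^sup>+x. ennreal b * indicator (ball g (2 * r)) x \<partial>lborel)"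
        using pb r by (intro nn_integral_mono) (auto simp: indicator_def ennreal_leI)
      also have "\<dots> = ennreal b * emeasure lborel (ball g (2 * r))"
        by (rule nn_integral_cmult_indicator) simp
      also have "\<dots> = ennreal b * ennreal ((2 * r) ^ DIM('a) * c)"
        using emeasure_lborel_ball_finite[of g "2 * r"] content_ball_conv_unit_ball[of "2 * r" g] r
        by (simp add: emeasure_eq_ennreal_measure c_def)
      finally have "measure D (cball g r) \<le> b * ((2 * r) ^ DIM('a) * c)"
        using bc r by (simp add: D.emeasure_eq_measure ennreal_mult[symmetric])
      also have "\<dots> = b * 2 ^ DIM('a) * c * r ^ DIM('a)" by (simp add: power_mult_distrib)
      also have "\<dots> \<le> b * 2 ^ DIM('a) * c * r ^ 5"
        using bc r True \<rho> dim by (intro mult_left_mono power_decreasing) auto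
      also have "\<dots> \<le> (b * 2 ^ DIM('a) * c + 1 / \<rho> ^ 5) * r ^ 5"
        using \<rho> r by (intro mult_right_mono) auto
      finally show ?thesis .
    next
      case False
      have "measure D (cball g r) \<le> 1" by (rule D.prob_le_1)
      also have "\<dots> \<le> 1 / \<rho> ^ 5 * r ^ 5"
        using False \<rho> by (simp add: pos_le_divide_eq power_mono)
      also have "\<dots> \<le> (b * 2 ^ DIM('a) * c + 1 / \<rho> ^ 5) * r ^ 5"
        using bc r by (intro mult_right_mono) auto
      finally show ?thesis .
    qed
  qed
qed

section \<open>Derivatives from quadratic remainders, and measurability\<close>

lemma has_derivative_of_quadratic_remainder:
  fixes f :: "'a::real_normed_vector \<Rightarrow> 'b::real_normed_vector"
  assumes "bounded_linear f'" "\<And>y. norm (f y - f x - f' (y - x)) \<le> K * (norm (y - x))\<^sup>2"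
  shows "(f has_derivative f') (at x)"
  unfolding has_derivative_at2
proof (intro conjI assms(1))
  have "((\<lambda>y. K * norm (y - x)) \<longlongrightarrow> K * norm (x - x)) (at x)"
    by (intro tendsto_intros)
  then have lim: "((\<lambda>y. K * norm (y - x)) \<longlongrightarrow> 0) (at x)" by simp
  show "((\<lambda>y. (1 / norm (y - x)) *\<^sub>R (f y - (f x + f' (y - x)))) \<longlongrightarrow> 0) (at x)"
  proof (rule Lim_null_comparison[OF _ lim])
    show "\<forall>\<^sub>F y in at x. norm ((1 / norm (y - x)) *\<^sub>R (f y - (f x + f' (y - x)))) \<le> K * norm (y - x)"
      using eventually_neq_at_within[of x]
    proof eventually_elim
      case (elim y)
      then show ?case
        using assms(2)[of y] by (simp add: divide_le_eq power2_eq_square diff_diff_eq mult.assoc)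
    qed
  qed
qed

lemma borel_measurable_sgn[measurable]:
  fixes f :: "'a \<Rightarrow> 'b::euclidean_space"
  assumes [measurable]: "f \<in> borel_measurable M"
  shows "(\<lambda>x. sgn (f x)) \<in> borel_measurable M"
  unfolding sgn_div_norm by measurable

lemma borel_measurable_matrix_vector_mult[measurable]:
  fixes A :: "real^'n^'m"
  assumes [measurable]: "f \<in> borel_measurable M"
  shows "(\<lambda>x. A *v f x) \<in> borel_measurable M"
proof -
  have "(*v) A \<in> borel_measurable borel"
    by (intro borel_measurable_continuous_onI linear_continuous_on linear_linear[THEN iffD2]) simp
  then show ?thesis by measurable
qed

lemma borel_measurable_mnorm_grad[measurable]:
  assumes [measurable]: "f \<in> borel_measurable M"
  shows "(\<lambda>x. mnorm_grad \<Sigma> (f x)) \<in> borel_measurable M"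
  unfolding mnorm_grad_def by measurable

lemma borel_measurable_mnorm[measurable]:
  assumes [measurable]: "f \<in> borel_measurable M"
  shows "(\<lambda>x. mnorm \<Sigma> (f x)) \<in> borel_measurable M"
  unfolding mnorm_def by measurable

lemma borel_measurable_mnorm_hess[measurable]:
  assumes [measurable]: "f \<in> borel_measurable M"
  shows "(\<lambda>x. mnorm_hess \<Sigma> (f x) v) \<in> borel_measurable M"
  unfolding mnorm_hess_def sgn_deriv_def by measurable

section \<open>The limit loss\<close>

text \<open>Collects what concerns the distribution and \<Sigma> only; the limit loss is studied
  before any preference matrix \<open>S\<close> appears.\<close>

locale skewed_setting =
  fixes D :: "(real^'d) measure" and p :: "real^'d \<Rightarrow> real" and \<Theta> :: "(real^'d) set"
    and \<Sigma> :: "real^'d^'d"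
  assumes dim: "CARD('d) \<ge> 5"
    and prob: "prob_space D"
    and \<Theta>: "open \<Theta>" "convex \<Theta>"
    and p_meas: "p \<in> borel_measurable borel"
    and density: "D = density lborel (\<lambda>x. ennreal (p x))"
    and p_C1: "cont_differentiable_on p \<Theta>"
    and supp: "measure D \<Theta> = 1"
    and moment: "integrable D (\<lambda>\<theta>. norm \<theta>)"
    and \<Sigma>: "pos_def_matrix \<Sigma>"
begin

sublocale prob_space D by (rule prob)

lemma sets_D [simp, measurable_cong]: "sets D = sets borel"
  by (simp add: density)

lemma AE_of_negligible:
  assumes "negligible N"
  shows "AE \<theta> in D. \<theta> \<notin> N"
proof -
  have "AE x in lebesgue. x \<notin> N"
    using assms by (simp add: AE_not_in negligible_iff_null_sets)
  then have "AE x in lborel. x \<notin> N" by (simp add: AE_completion_iff)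
  then show ?thesis
    unfolding density using p_meas by (subst AE_density) auto
qed

lemma AE_neq: "AE \<theta> in D. z - \<theta> \<noteq> 0"
  using AE_of_negligible[of "{z}"] by (auto elim: eventually_mono)

lemma AE_mem: "AE \<theta> in D. \<theta> \<in> \<Theta>"
  by (rule AE_prob_1[OF supp])

lemma integrable_mnorm: "integrable D (\<lambda>\<theta>. mnorm \<Sigma> (z - \<theta>))"
proof -
  obtain C where C: "C > 0" "\<And>x. norm (\<Sigma> *v x) \<le> C * norm x"
    using matrix_vector_norm_bound[of \<Sigma>] by blast
  show ?thesis
  proof (rule Bochner_Integration.integrable_bound)
    show "integrable D (\<lambda>\<theta>. C * (norm z + norm \<theta>))" using moment by simp
    show "AE \<theta> in D. norm (mnorm \<Sigma> (z - \<theta>)) \<le> norm (C * (norm z + norm \<theta>))"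
    proof (rule AE_I2)
      fix \<theta>
      have "mnorm \<Sigma> (z - \<theta>) \<le> C * norm (z - \<theta>)" unfolding mnorm_def by (rule C)
      also have "\<dots> \<le> C * (norm z + norm \<theta>)" using C(1) norm_triangle_ineq4 by (intro mult_left_mono) auto
      finally show "norm (mnorm \<Sigma> (z - \<theta>)) \<le> norm (C * (norm z + norm \<theta>))"
        using C(1) by (simp add: mnorm_def)
    qed
  qed measurable
qed

lemma integrable_mnorm_grad: "integrable D (\<lambda>\<theta>. mnorm_grad \<Sigma> (z - \<theta>))"
proof -
  obtain C where C: "C > 0" "\<And>x. norm (\<Sigma> *v x) \<le> C * norm x"
    using matrix_vector_norm_bound[of \<Sigma>] by blast
  show ?thesis
    using norm_mnorm_grad_le[OF C(2)] C(1) by (intro integrable_const_bound[of _ C]) auto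
qed

definition mean_grad :: "real^'d \<Rightarrow> real^'d" where
  "mean_grad z = (LINT \<theta>|D. mnorm_grad \<Sigma> (z - \<theta>))"

definition mean_hess :: "real^'d \<Rightarrow> real^'d \<Rightarrow> real^'d" where
  "mean_hess z v = (LINT \<theta>|D. mnorm_hess \<Sigma> (z - \<theta>) v)"

text \<open>Membership in \<Theta> makes the density continuous at \<open>z\<close>, which gives the
  small-ball bound; \<Sigma> shrinks distances by at most a constant factor.\<close>

lemma integrable_inverse_square:
  assumes "z \<in> \<Theta>"
  shows "integrable D (\<lambda>\<theta>. 1 / (norm (\<Sigma> *v (z - \<theta>)))\<^sup>2)"
proof -
  obtain c where c: "c > 0" "\<And>x. c * norm x \<le> norm (\<Sigma> *v x)"
    using pos_def_norm_bound[OF \<Sigma>] by blast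
  have "isCont p z"
    using p_C1 assms has_derivative_continuous
    unfolding cont_differentiable_on_def gderiv_def by blast
  then obtain K where "\<And>r. 0 < r \<Longrightarrow> measure D (cball z r) \<le> K * r ^ 5"
    using density_small_ball[of D p z] dim prob density p_meas by auto
  then have int: "integrable D (\<lambda>\<theta>. 1 / (norm (z - \<theta>))\<^sup>2)"
    by (intro integrable_inverse_square_dist[where K = K]) (use prob in auto)
  show ?thesis
  proof (rule Bochner_Integration.integrable_bound)
    show "integrable D (\<lambda>\<theta>. 1 / c\<^sup>2 * (1 / (norm (z - \<theta>))\<^sup>2))" using int by (rule integrable_mult_right)
    show "AE \<theta> in D. norm (1 / (norm (\<Sigma> *v (z - \<theta>)))\<^sup>2) \<le> norm (1 / c\<^sup>2 * (1 / (norm (z - \<theta>))\<^sup>2))"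
      using AE_neq[of z]
    proof eventually_elim
      case (elim \<theta>)
      then have "0 < c * norm (z - \<theta>)" using c(1) by simp
      then have "1 / (norm (\<Sigma> *v (z - \<theta>)))\<^sup>2 \<le> 1 / (c * norm (z - \<theta>))\<^sup>2"
        using c(2)[of "z - \<theta>"] by (intro divide_left_mono power_mono mult_pos_pos) auto
      then show ?case by (simp add: power_mult_distrib)
    qed
  qed measurable
qed

lemma integrable_inverse:
  assumes "z \<in> \<Theta>"
  shows "integrable D (\<lambda>\<theta>. 1 / norm (\<Sigma> *v (z - \<theta>)))"
proof (rule Bochner_Integration.integrable_bound)
  show "integrable D (\<lambda>\<theta>. 1 + 1 / (norm (\<Sigma> *v (z - \<theta>)))\<^sup>2)"
    using integrable_inverse_square[OF assms] by simp
  show "AE \<theta> in D. norm (1 / norm (\<Sigma> *v (z - \<theta>))) \<le> norm (1 + 1 / (norm (\<Sigma> *v (z - \<theta>)))\<^sup>2)"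
  proof (rule AE_I2)
    fix \<theta>
    have "x \<le> 1 + x\<^sup>2" for x :: real
      using zero_le_power2[of "x - 1"] zero_le_power2[of x] unfolding power2_diff power_one by linarith
    from this[of "1 / norm (\<Sigma> *v (z - \<theta>))"]
    show "norm (1 / norm (\<Sigma> *v (z - \<theta>))) \<le> norm (1 + 1 / (norm (\<Sigma> *v (z - \<theta>)))\<^sup>2)"
      by (simp add: power_divide)
  qed
qed measurable

lemma integrable_mnorm_hess:
  assumes "z \<in> \<Theta>"
  shows "integrable D (\<lambda>\<theta>. mnorm_hess \<Sigma> (z - \<theta>) v)"
proof -
  obtain C where C: "C > 0" "\<And>x. norm (\<Sigma> *v x) \<le> C * norm x"
    using matrix_vector_norm_bound[of \<Sigma>] by blast
  show ?thesis
  proof (rule Bochner_Integration.integrable_bound)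
    show "integrable D (\<lambda>\<theta>. C\<^sup>2 * norm v * (1 / norm (\<Sigma> *v (z - \<theta>))))"
      using integrable_inverse[OF assms] by (rule integrable_mult_right)
    show "AE \<theta> in D. norm (mnorm_hess \<Sigma> (z - \<theta>) v) \<le> norm (C\<^sup>2 * norm v * (1 / norm (\<Sigma> *v (z - \<theta>))))"
      using norm_mnorm_hess_le[OF C(2), of "z - _" v] C(1) by (intro AE_I2) (simp add: abs_mult)
  qed measurable
qed

lemma integrable_mnorm_hess_square:
  assumes "z \<in> \<Theta>"
  shows "integrable D (\<lambda>\<theta>. (mnorm_hess \<Sigma> (z - \<theta>) v \<bullet> w)\<^sup>2)"
proof -
  obtain C where C: "C > 0" "\<And>x. norm (\<Sigma> *v x) \<le> C * norm x"
    using matrix_vector_norm_bound[of \<Sigma>] by blast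
  show ?thesis
  proof (rule Bochner_Integration.integrable_bound)
    show "integrable D (\<lambda>\<theta>. (C\<^sup>2 * norm v * norm w)\<^sup>2 * (1 / (norm (\<Sigma> *v (z - \<theta>)))\<^sup>2))"
      using integrable_inverse_square[OF assms] by (rule integrable_mult_right)
    show "AE \<theta> in D. norm ((mnorm_hess \<Sigma> (z - \<theta>) v \<bullet> w)\<^sup>2)
        \<le> norm ((C\<^sup>2 * norm v * norm w)\<^sup>2 * (1 / (norm (\<Sigma> *v (z - \<theta>)))\<^sup>2))"
    proof (rule AE_I2)
      fix \<theta>
      have "\<bar>mnorm_hess \<Sigma> (z - \<theta>) v \<bullet> w\<bar> \<le> norm (mnorm_hess \<Sigma> (z - \<theta>) v) * norm w"
        by (rule Cauchy_Schwarz_ineq2)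
      also have "\<dots> \<le> C\<^sup>2 * norm v / norm (\<Sigma> *v (z - \<theta>)) * norm w"
        using C by (intro mult_right_mono norm_mnorm_hess_le) auto
      finally have "\<bar>mnorm_hess \<Sigma> (z - \<theta>) v \<bullet> w\<bar>\<^sup>2 \<le> (C\<^sup>2 * norm v / norm (\<Sigma> *v (z - \<theta>)) * norm w)\<^sup>2"
        by (rule power_mono) simp
      then show "norm ((mnorm_hess \<Sigma> (z - \<theta>) v \<bullet> w)\<^sup>2)
        \<le> norm ((C\<^sup>2 * norm v * norm w)\<^sup>2 * (1 / (norm (\<Sigma> *v (z - \<theta>)))\<^sup>2))"
        by (simp add: power_mult_distrib power_divide)
    qed
  qed measurable
qed

lemma limit_loss_subgradient:
  "limit_loss \<Sigma> D z + mean_grad z \<bullet> (y - z) \<le> limit_loss \<Sigma> D y"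
proof -
  have "limit_loss \<Sigma> D z + mean_grad z \<bullet> (y - z)
      = (LINT \<theta>|D. mnorm \<Sigma> (z - \<theta>) + mnorm_grad \<Sigma> (z - \<theta>) \<bullet> (y - z))"
    unfolding limit_loss_def mean_grad_def
    using integrable_mnorm integrable_mnorm_grad
    by (simp add: Bochner_Integration.integral_add)
  also have "\<dots> \<le> limit_loss \<Sigma> D y"
    unfolding limit_loss_def
  proof (rule integral_mono)
    show "mnorm \<Sigma> (z - \<theta>) + mnorm_grad \<Sigma> (z - \<theta>) \<bullet> (y - z) \<le> mnorm \<Sigma> (y - \<theta>)" for \<theta>
      using mnorm_subgradient[OF \<Sigma>, of "z - \<theta>" "y - \<theta>"] by simp
  qed (use integrable_mnorm integrable_mnorm_grad in auto)
  finally show ?thesis .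
qed

text \<open>The loss is squeezed between its tangent, from the subgradient inequality, and the
  tangent plus a square whose coefficient is an integrable inverse distance. Differentiability
  follows without exchanging limit and integral.\<close>

lemma gderiv_limit_loss:
  assumes "z \<in> \<Theta>"
  shows "GDERIV (limit_loss \<Sigma> D) z :> mean_grad z"
proof -
  obtain C where C: "C > 0" "\<And>x. norm (\<Sigma> *v x) \<le> C * norm x"
    using matrix_vector_norm_bound[of \<Sigma>] by blast
  define K where "K = (LINT \<theta>|D. 1 / norm (\<Sigma> *v (z - \<theta>)))"
  have K: "0 \<le> K" unfolding K_def by (rule integral_nonneg_AE) simp
  have up: "limit_loss \<Sigma> D y \<le> limit_loss \<Sigma> D z + mean_grad z \<bullet> (y - z)
      + 2 * (norm (\<Sigma> *v (y - z)))\<^sup>2 * K" for y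
  proof -
    have "limit_loss \<Sigma> D y \<le> (LINT \<theta>|D. mnorm \<Sigma> (z - \<theta>) + mnorm_grad \<Sigma> (z - \<theta>) \<bullet> (y - z)
        + 2 * (norm (\<Sigma> *v (y - z)))\<^sup>2 * (1 / norm (\<Sigma> *v (z - \<theta>))))"
      unfolding limit_loss_def
    proof (rule integral_mono_AE)
      show "AE \<theta> in D. mnorm \<Sigma> (y - \<theta>) \<le> mnorm \<Sigma> (z - \<theta>) + mnorm_grad \<Sigma> (z - \<theta>) \<bullet> (y - z)
        + 2 * (norm (\<Sigma> *v (y - z)))\<^sup>2 * (1 / norm (\<Sigma> *v (z - \<theta>)))"
        using AE_neq[of z]
      proof eventually_elim
        case (elim \<theta>)
        show ?case using mnorm_le_second_order[OF \<Sigma> elim, of "y - \<theta>"] by simp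
      qed
      show "integrable D (\<lambda>\<theta>. mnorm \<Sigma> (z - \<theta>) + mnorm_grad \<Sigma> (z - \<theta>) \<bullet> (y - z)
        + 2 * (norm (\<Sigma> *v (y - z)))\<^sup>2 * (1 / norm (\<Sigma> *v (z - \<theta>))))"
        by (intro Bochner_Integration.integrable_add integrable_mult_right integrable_inverse assms
            integrable_inner_left integrable_mnorm integrable_mnorm_grad)
    qed (rule integrable_mnorm)
    also have "\<dots> = limit_loss \<Sigma> D z + mean_grad z \<bullet> (y - z) + 2 * (norm (\<Sigma> *v (y - z)))\<^sup>2 * K"
      unfolding limit_loss_def mean_grad_def K_def integral_mult_right_zero[symmetric]
        integral_inner_left[OF integrable_mnorm_grad, symmetric]
      by (subst Bochner_Integration.integral_add;
          intro Bochner_Integration.integrable_add integrable_mult_right integrable_inverse assms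
            integrable_inner_left integrable_mnorm integrable_mnorm_grad refl
            Bochner_Integration.integral_add arg_cong2[where f = "(+)"])
    finally show ?thesis .
  qed
  show ?thesis
    unfolding gderiv_def
  proof (rule has_derivative_of_quadratic_remainder[where K = "2 * C\<^sup>2 * K"])
    show "bounded_linear (\<lambda>h. h \<bullet> mean_grad z)" by (rule bounded_linear_inner_left)
    fix y
    have "(norm (\<Sigma> *v (y - z)))\<^sup>2 \<le> (C * norm (y - z))\<^sup>2" by (intro power_mono C) simp
    then have "2 * (norm (\<Sigma> *v (y - z)))\<^sup>2 * K \<le> 2 * (C * norm (y - z))\<^sup>2 * K"
      using K by (intro mult_right_mono) auto
    then show "norm (limit_loss \<Sigma> D y - limit_loss \<Sigma> D z - (y - z) \<bullet> mean_grad z)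
        \<le> 2 * C\<^sup>2 * K * (norm (y - z))\<^sup>2"
      using up[of y] limit_loss_subgradient[of z y]
      by (simp add: inner_commute[of "y - z"] power_mult_distrib mult_ac)
  qed
qed

lemma grad_limit_loss:
  assumes "z \<in> \<Theta>"
  shows "grad (limit_loss \<Sigma> D) z = mean_grad z"
  unfolding grad_def
proof (rule the_equality[where P = "\<lambda>D'. GDERIV (limit_loss \<Sigma> D) z :> D'"])
  show "GDERIV (limit_loss \<Sigma> D) z :> mean_grad z" by (rule gderiv_limit_loss[OF assms])
  fix d assume "GDERIV (limit_loss \<Sigma> D) z :> d"
  with gderiv_limit_loss[OF assms] have "(\<lambda>h. h \<bullet> d) = (\<lambda>h. h \<bullet> mean_grad z)"
    unfolding gderiv_def by (rule has_derivative_unique[rotated])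
  then show "d = mean_grad z" by (metis inner_commute vector_eq_rdot)
qed

lemma linear_mean_hess:
  assumes "z \<in> \<Theta>"
  shows "linear (mean_hess z)"
  unfolding mean_hess_def using integrable_mnorm_hess[OF assms]
  by (intro linearI) (simp_all add: linear_add[OF linear_mnorm_hess] linear_scale[OF linear_mnorm_hess])

text \<open>The pointwise remainder bound is valid for all \<open>y\<close> and carries the weight 1
  / |\<Sigma> (z - \<theta>)|^2, which is integrable; integrating it gives a quadratic remainder
  again.\<close>

lemma has_derivative_mean_grad:
  assumes "z \<in> \<Theta>"
  shows "(mean_grad has_derivative mean_hess z) (at z)"
proof -
  obtain C where C: "C > 0" "\<And>x. norm (\<Sigma> *v x) \<le> C * norm x"
    using matrix_vector_norm_bound[of \<Sigma>] by blast
  define K where "K = (LINT \<theta>|D. 1 / (norm (\<Sigma> *v (z - \<theta>)))\<^sup>2)"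
  show ?thesis
  proof (rule has_derivative_of_quadratic_remainder[where K = "4 * C ^ 3 * K"])
    show "bounded_linear (mean_hess z)"
      using linear_mean_hess[OF assms] by (simp add: linear_conv_bounded_linear)
    fix y
    let ?R = "\<lambda>\<theta>. mnorm_grad \<Sigma> (y - \<theta>) - mnorm_grad \<Sigma> (z - \<theta>) - mnorm_hess \<Sigma> (z - \<theta>) (y - z)"
    have "mean_grad y - mean_grad z - mean_hess z (y - z) = (LINT \<theta>|D. ?R \<theta>)"
      unfolding mean_grad_def mean_hess_def
      using integrable_mnorm_grad integrable_mnorm_hess[OF assms] by simp
    also have "norm \<dots> \<le> (LINT \<theta>|D. norm (?R \<theta>))" by (rule integral_norm_bound)
    also have "\<dots> \<le> (LINT \<theta>|D. 4 * C ^ 3 * (norm (y - z))\<^sup>2 * (1 / (norm (\<Sigma> *v (z - \<theta>)))\<^sup>2))"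
    proof (rule integral_mono_AE)
      show "AE \<theta> in D. norm (?R \<theta>) \<le> 4 * C ^ 3 * (norm (y - z))\<^sup>2 * (1 / (norm (\<Sigma> *v (z - \<theta>)))\<^sup>2)"
        using AE_neq[of z]
      proof eventually_elim
        case (elim \<theta>)
        show ?case
          using norm_mnorm_grad_remainder_le[OF \<Sigma> C(2) _ elim, of "y - \<theta>"] C(1) by simp
      qed
      show "integrable D (\<lambda>\<theta>. 4 * C ^ 3 * (norm (y - z))\<^sup>2 * (1 / (norm (\<Sigma> *v (z - \<theta>)))\<^sup>2))"
        by (intro integrable_mult_right integrable_inverse_square assms)
    qed (use integrable_mnorm_grad integrable_mnorm_hess[OF assms] in auto)
    also have "\<dots> = 4 * C ^ 3 * K * (norm (y - z))\<^sup>2"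
      unfolding integral_mult_right_zero K_def by (simp only: mult_ac)
    finally show "norm (mean_grad y - mean_grad z - mean_hess z (y - z)) \<le> 4 * C ^ 3 * K * (norm (y - z))\<^sup>2" .
  qed
qed

lemma hessian_limit_loss:
  assumes "z \<in> \<Theta>"
  shows "hessian (limit_loss \<Sigma> D) z *v v = mean_hess z v"
proof -
  \<comment> \<open>The formula for \<open>grad\<close> holds only on \<Theta>, but \<Theta> is an
    open neighbourhood of \<open>z\<close>.\<close>
  have "(grad (limit_loss \<Sigma> D) has_derivative mean_hess z) (at z)"
    by (rule has_derivative_transform_within_open[OF has_derivative_mean_grad[OF assms] \<Theta>(1) assms])
      (simp add: grad_limit_loss)
  then have "frechet_derivative (grad (limit_loss \<Sigma> D)) (at z) = mean_hess z"
    by (rule frechet_derivative_at[symmetric])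
  then show ?thesis
    unfolding hessian_def jacobian_def using linear_mean_hess[OF assms] by (simp add: matrix_works)
qed

text \<open>For strictness: if the form vanished at \<open>v\<close>, almost every \<theta> would
  give equality in Cauchy-Schwarz, making \<open>z - \<theta>\<close> parallel to \<open>v\<close>.
  A vector \<open>a\<close> orthogonal to \<open>v\<close> then confines \<theta> to a hyperplane
  through \<open>z\<close>, which is a null set for a distribution with a density.\<close>

lemma pos_def_hessian:
  assumes "z \<in> \<Theta>"
  shows "pos_def_matrix (hessian (limit_loss \<Sigma> D) z)" (is "pos_def_matrix ?H")
  unfolding pos_def_matrix_def
proof (intro conjI allI impI)
  have inner: "mean_hess z v \<bullet> w = (LINT \<theta>|D. mnorm_hess \<Sigma> (z - \<theta>) v \<bullet> w)" for v w
    unfolding mean_hess_def using integrable_mnorm_hess[OF assms] by simp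
  have sym: "(?H *v v) \<bullet> w = v \<bullet> (?H *v w)" for v w
    unfolding hessian_limit_loss[OF assms] inner inner_commute[of v "mean_hess z w"]
    by (simp only: mnorm_hess_sym[OF \<Sigma>, of _ v w] inner_commute[of v])
  have "transpose ?H *v v = ?H *v v" for v
  proof (rule vector_eq_ldot[THEN iffD1, rule_format])
    fix w
    show "w \<bullet> (transpose ?H *v v) = w \<bullet> (?H *v v)"
      by (metis sym dot_lmul_matrix inner_commute transpose_matrix_vector)
  qed
  then show "transpose ?H = ?H" by (simp add: matrix_eq)
  fix v :: "real^'d" assume v: "v \<noteq> 0"
  define q where "q \<theta> = v \<bullet> mnorm_hess \<Sigma> (z - \<theta>) v" for \<theta>
  have q: "integrable D q" unfolding q_def using integrable_mnorm_hess[OF assms] by simp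
  have q0: "0 \<le> q \<theta>" for \<theta>
    unfolding q_def mnorm_hess_def pos_def_inner_commute[OF \<Sigma>, symmetric] by (rule inner_sgn_deriv_nonneg)
  have eq: "v \<bullet> (?H *v v) = (LINT \<theta>|D. q \<theta>)"
    unfolding hessian_limit_loss[OF assms] q_def mean_hess_def using integrable_mnorm_hess[OF assms] by simp
  have "(LINT \<theta>|D. q \<theta>) \<noteq> 0"
  proof
    assume "(LINT \<theta>|D. q \<theta>) = 0"
    then have "AE \<theta> in D. q \<theta> = 0" using integral_nonneg_eq_0_iff_AE[OF q] q0 by simp
    obtain a where a: "a \<noteq> 0" "orthogonal v a"
      using orthogonal_to_vector_exists[of v] dim by auto
    have "negligible {x. a \<bullet> x = a \<bullet> z}" using a(1) by (intro negligible_hyperplane) simp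
    then have "AE \<theta> in D. a \<bullet> \<theta> \<noteq> a \<bullet> z" using AE_of_negligible[of "{x. a \<bullet> x = a \<bullet> z}"] by simp
    with \<open>AE \<theta> in D. q \<theta> = 0\<close> AE_neq[of z] have "AE \<theta> in D. False"
    proof eventually_elim
      case (elim \<theta>)
      let ?w = "z - \<theta>"
      have n: "norm (\<Sigma> *v ?w) > 0" using elim \<Sigma> by (simp add: pos_def_vector_eq_0_iff)
      have "(norm (\<Sigma> *v v))\<^sup>2 = (sgn (\<Sigma> *v ?w) \<bullet> (\<Sigma> *v v))\<^sup>2"
        using elim n by (simp add: q_def inner_mnorm_hess[OF \<Sigma>])
      then have "\<bar>sgn (\<Sigma> *v ?w) \<bullet> (\<Sigma> *v v)\<bar> = norm (sgn (\<Sigma> *v ?w)) * norm (\<Sigma> *v v)"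
        using n by (simp add: norm_sgn power2_eq_iff abs_eq_iff') (metis abs_norm_cancel power2_eq_iff abs_minus_cancel)
      then have "collinear {0, sgn (\<Sigma> *v ?w), \<Sigma> *v v}"
        by (simp add: norm_cauchy_schwarz_equal)
      then obtain c where "\<Sigma> *v v = c *\<^sub>R sgn (\<Sigma> *v ?w) \<or> sgn (\<Sigma> *v ?w) = 0"
        unfolding collinear_lemma by (metis scaleR_zero_left)
      then have "\<Sigma> *v v = c *\<^sub>R sgn (\<Sigma> *v ?w)" using n by (auto simp: sgn_zero_iff)
      then have "\<Sigma> *v v = \<Sigma> *v ((c / norm (\<Sigma> *v ?w)) *\<^sub>R ?w)"
        by (simp add: sgn_div_norm matrix_vector_mult_scaleR divide_inverse)
      then have "\<Sigma> *v (v - (c / norm (\<Sigma> *v ?w)) *\<^sub>R ?w) = 0"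
        by (simp add: matrix_vector_mult_diff_distrib)
      then have vw: "v = (c / norm (\<Sigma> *v ?w)) *\<^sub>R ?w" using \<Sigma> by (simp add: pos_def_vector_eq_0_iff)
      then have "(c / norm (\<Sigma> *v ?w)) * (a \<bullet> ?w) = 0"
        using a(2) by (metis inner_commute inner_scaleR_right orthogonal_def)
      moreover have "c / norm (\<Sigma> *v ?w) \<noteq> 0" using vw v by auto
      ultimately have "a \<bullet> ?w = 0" by simp
      then show ?case using elim by (simp add: inner_diff_right)
    qed
    then show False by simp
  qed
  moreover have "0 \<le> (LINT \<theta>|D. q \<theta>)" using q0 by (intro integral_nonneg_AE) auto
  ultimately show "0 < v \<bullet> (?H *v v)" unfolding eq by simp
qed

text \<open>\<open>limit_gm\<close> is a choice, so a minimizer must first be shown to exist. The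
  loss is Lipschitz and at least \<open>c * norm z\<close> minus its value at 0; beyond the radius
  \<open>r\<close> it therefore exceeds that value, and a compact ball suffices.\<close>

lemma limit_gm_minimal: "limit_loss \<Sigma> D (limit_gm \<Sigma> D) \<le> limit_loss \<Sigma> D z"
proof -
  obtain C where C: "C > 0" "\<And>x. norm (\<Sigma> *v x) \<le> C * norm x"
    using matrix_vector_norm_bound[of \<Sigma>] by blast
  obtain c where c: "c > 0" "\<And>x. c * norm x \<le> norm (\<Sigma> *v x)"
    using pos_def_norm_bound[OF \<Sigma>] by blast
  let ?L = "limit_loss \<Sigma> D"
  have le: "?L y \<le> ?L z + C * norm (y - z)" for y z
  proof -
    have "?L y \<le> (LINT \<theta>|D. mnorm \<Sigma> (z - \<theta>) + C * norm (y - z))"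
      unfolding limit_loss_def
    proof (rule integral_mono)
      show "mnorm \<Sigma> (y - \<theta>) \<le> mnorm \<Sigma> (z - \<theta>) + C * norm (y - z)" for \<theta>
        using mnorm_triangle[of \<Sigma> "z - \<theta>" "y - z"] C(2)[of "y - z"] by (simp add: mnorm_def)
    qed (use integrable_mnorm in auto)
    also have "\<dots> = ?L z + C * norm (y - z)"
      unfolding limit_loss_def using integrable_mnorm[of z] by (simp add: prob_space)
    finally show ?thesis .
  qed
  have "C-lipschitz_on UNIV ?L"
  proof (rule lipschitz_onI)
    show "dist (?L y) (?L z) \<le> C * dist y z" for y z
      using le[of y z] le[of z y] by (simp add: dist_real_def dist_norm norm_minus_commute)
  qed (use C in simp)
  then have cont: "continuous_on A ?L" for A
    using lipschitz_on_continuous_on continuous_on_subset by blast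
  define r where "r = 2 * ?L 0 / c"
  have L0: "0 \<le> ?L 0" unfolding limit_loss_def by (rule integral_nonneg_AE) (simp add: mnorm_def)
  have low: "c * norm z - ?L 0 \<le> ?L z" for z
  proof -
    have "c * norm z - ?L 0 = (LINT \<theta>|D. c * norm z - mnorm \<Sigma> (0 - \<theta>))"
      unfolding limit_loss_def using integrable_mnorm[of 0] by (simp add: prob_space)
    also have "\<dots> \<le> ?L z"
      unfolding limit_loss_def
    proof (rule integral_mono)
      show "c * norm z - mnorm \<Sigma> (0 - \<theta>) \<le> mnorm \<Sigma> (z - \<theta>)" for \<theta>
        using mnorm_triangle[of \<Sigma> "z - \<theta>" "- (0 - \<theta>)"] c(2)[of z] mnorm_scaleR[of \<Sigma> "-1" "0 - \<theta>"]
        by (simp add: mnorm_def)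
    qed (intro Bochner_Integration.integrable_diff integrable_mnorm integrable_const)+
    finally show ?thesis .
  qed
  have r: "0 \<le> r" unfolding r_def using L0 c(1) by simp
  have "\<exists>g\<in>cball 0 r. \<forall>z\<in>cball 0 r. ?L g \<le> ?L z"
    by (rule continuous_attains_inf[OF compact_cball _ cont]) (use r in auto)
  then obtain g where g: "\<And>z. z \<in> cball 0 r \<Longrightarrow> ?L g \<le> ?L z" by blast
  have "?L g \<le> ?L z" for z
  proof (cases "z \<in> cball 0 r")
    case False
    then have "r < norm z" by simp
    then have "2 * ?L 0 < c * norm z" using c(1) by (simp add: r_def pos_divide_less_eq mult.commute)
    then have "?L 0 \<le> ?L z" using low[of z] by simp
    then show ?thesis using g[of 0] r by simp
  qed (rule g)
  then have "is_arg_min ?L (\<lambda>_. True) g" by (simp add: is_arg_min_linorder)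
  then have "is_arg_min ?L (\<lambda>_. True) (limit_gm \<Sigma> D)"
    unfolding limit_gm_def arg_min_def by (rule someI)
  then show ?thesis by (simp add: is_arg_min_linorder)
qed

text \<open>Were the median outside the convex set, a hyperplane would have almost all mass strictly
  on one side, and a step towards that side would lower the loss.\<close>

lemma limit_gm_mem: "limit_gm \<Sigma> D \<in> \<Theta>"
proof (rule ccontr)
  define g where "g = limit_gm \<Sigma> D"
  assume "limit_gm \<Sigma> D \<notin> \<Theta>"
  then have g: "g \<notin> \<Theta>" by (simp add: g_def)
  have "\<Theta> \<noteq> {}" using supp by auto
  then obtain u b where u: "u \<noteq> 0" "u \<bullet> g \<le> b" "\<And>x. x \<in> \<Theta> \<Longrightarrow> b \<le> u \<bullet> x"
    using separating_hyperplane_sets[of "{g}" \<Theta>] \<Theta>(2) g by auto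
  \<comment> \<open>The separation is weak at first; openness leaves room for a step of length e / 2
    against \<open>u\<close>, which makes it strict.\<close>
  have sep: "u \<bullet> (g - \<theta>) < 0" if "\<theta> \<in> \<Theta>" for \<theta>
  proof -
    obtain e where e: "e > 0" "ball \<theta> e \<subseteq> \<Theta>" using \<Theta>(1) \<open>\<theta> \<in> \<Theta>\<close> openE by blast
    define x where "x = \<theta> - (e / 2) *\<^sub>R sgn u"
    have "x \<in> \<Theta>" using e u(1) by (intro subsetD[OF e(2)]) (simp add: x_def dist_norm norm_sgn)
    then have "b \<le> u \<bullet> \<theta> - e / 2 * (sgn u \<bullet> u)" using u(3)[of x] by (simp add: x_def inner_diff_right inner_commute)
    moreover have "sgn u \<bullet> u > 0" using u(1) norm_eq_sgn_inner[of u] by (metis zero_less_norm_iff)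
    ultimately show ?thesis using e(1) u(2) by (simp add: inner_diff_right) (smt (verit) mult_pos_pos half_gt_zero)
  qed
  \<comment> \<open>The direction is \<Sigma>^(-2) u, so that the skewed gradient at
    \<open>w\<close> paired with \<open>v\<close> has the sign of
    \<open>u \<bullet> w\<close>.\<close>
  define v where "v = matrix_inv \<Sigma> *v (matrix_inv \<Sigma> *v u)"
  have \<Sigma>v: "\<Sigma> *v (\<Sigma> *v v) = u"
    unfolding v_def by (metis matrix_vector_mul_assoc matrix_vector_mul_lid pos_def_matrix_inv(1)[OF \<Sigma>])
  have gv: "mnorm_grad \<Sigma> w \<bullet> v = (u \<bullet> w) / norm (\<Sigma> *v w)" for w
  proof -
    have "mnorm_grad \<Sigma> w \<bullet> v = sgn (\<Sigma> *v w) \<bullet> (\<Sigma> *v v)"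
      unfolding mnorm_grad_def by (rule pos_def_inner_commute[OF \<Sigma>])
    also have "\<dots> = ((\<Sigma> *v w) \<bullet> (\<Sigma> *v v)) / norm (\<Sigma> *v w)" by (simp add: sgn_div_norm divide_inverse)
    also have "(\<Sigma> *v w) \<bullet> (\<Sigma> *v v) = w \<bullet> u" unfolding pos_def_inner_commute[OF \<Sigma>] \<Sigma>v ..
    finally show ?thesis by (simp add: inner_commute)
  qed
  obtain C where C: "C > 0" "\<And>x. norm (\<Sigma> *v x) \<le> C * norm x"
    using matrix_vector_norm_bound[of \<Sigma>] by blast
  define h where "h n = 1 / real (Suc n)" for n
  let ?f = "\<lambda>z \<theta>. mnorm_grad \<Sigma> (z - \<theta>) \<bullet> v"
  have pos: "0 \<le> (LINT \<theta>|D. ?f (g + h n *\<^sub>R v) \<theta>)" for n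
  proof -
    let ?z = "g + h n *\<^sub>R v"
    have "limit_loss \<Sigma> D ?z - h n * (mean_grad ?z \<bullet> v) \<le> limit_loss \<Sigma> D g"
      using limit_loss_subgradient[of ?z g] by simp
    moreover have "limit_loss \<Sigma> D g \<le> limit_loss \<Sigma> D ?z" unfolding g_def by (rule limit_gm_minimal)
    ultimately have "0 \<le> h n * (mean_grad ?z \<bullet> v)" by simp
    then have "0 \<le> mean_grad ?z \<bullet> v" by (simp add: h_def zero_le_mult_iff zero_le_divide_iff)
    then show ?thesis unfolding mean_grad_def using integrable_mnorm_grad by simp
  qed
  have "(\<lambda>n. LINT \<theta>|D. ?f (g + h n *\<^sub>R v) \<theta>) \<longlonglongrightarrow> (LINT \<theta>|D. ?f g \<theta>)"
  proof (rule integral_dominated_convergence[where w = "\<lambda>_. C * norm v"])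
    show "AE \<theta> in D. (\<lambda>n. ?f (g + h n *\<^sub>R v) \<theta>) \<longlonglongrightarrow> ?f g \<theta>"
      using AE_neq[of g]
    proof eventually_elim
      case (elim \<theta>)
      have h0: "h \<longlonglongrightarrow> 0" unfolding h_def by (rule LIMSEQ_Suc) (rule lim_1_over_n)
      have "(\<lambda>n. g + h n *\<^sub>R v - \<theta>) \<longlonglongrightarrow> g + 0 *\<^sub>R v - \<theta>"
        by (intro tendsto_intros h0)
      then have t: "(\<lambda>n. g + h n *\<^sub>R v - \<theta>) \<longlonglongrightarrow> g - \<theta>" by simp
      have ct: "isCont ((*v) \<Sigma>) x" for x
        by (rule linear_continuous_at) (simp add: linear_linear)
      show ?case unfolding gv
        by (intro tendsto_intros t isCont_tendsto_compose[OF ct])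
          (use elim \<Sigma> in \<open>simp add: pos_def_vector_eq_0_iff\<close>)
    qed
    show "AE \<theta> in D. norm (?f (g + h n *\<^sub>R v) \<theta>) \<le> C * norm v" for n
    proof (rule AE_I2)
      fix \<theta>
      have "norm (?f (g + h n *\<^sub>R v) \<theta>) \<le> norm (mnorm_grad \<Sigma> (g + h n *\<^sub>R v - \<theta>)) * norm v"
        unfolding real_norm_def by (rule Cauchy_Schwarz_ineq2)
      also have "\<dots> \<le> C * norm v" using C by (intro mult_right_mono norm_mnorm_grad_le) auto
      finally show "norm (?f (g + h n *\<^sub>R v) \<theta>) \<le> C * norm v" .
    qed
  qed auto
  then have lim: "0 \<le> (LINT \<theta>|D. ?f g \<theta>)" by (rule LIMSEQ_le_const) (use pos in auto)
  have int: "integrable D (?f g)" using integrable_mnorm_grad by simp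
  have neg: "AE \<theta> in D. ?f g \<theta> < 0"
    using AE_mem AE_neq[of g]
  proof eventually_elim
    case (elim \<theta>)
    then have "norm (\<Sigma> *v (g - \<theta>)) > 0" using \<Sigma> by (simp add: pos_def_vector_eq_0_iff)
    then show ?case unfolding gv using sep[OF elim(1)] by (simp add: divide_neg_pos)
  qed
  have "(LINT \<theta>|D. ?f g \<theta>) < (LINT \<theta>|D. 0)"
    by (rule integral_less_AE_space[OF int]) (use neg in \<open>auto simp: emeasure_space_1\<close>)
  then show False using lim by simp
qed

lemma mean_grad_limit_gm: "mean_grad (limit_gm \<Sigma> D) = 0"
proof -
  have "(\<lambda>h. h \<bullet> mean_grad (limit_gm \<Sigma> D)) = (\<lambda>h. 0)"
    using differential_zero_maxmin[OF _ open_UNIV gderiv_limit_loss[OF limit_gm_mem, unfolded gderiv_def]]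
      limit_gm_minimal by simp
  then show ?thesis by (metis inner_eq_zero_iff)
qed

end

section \<open>Asymptotic strategyproofness\<close>

text \<open>Reduces a deviation bound uniform in \<open>u\<close> to finitely many scalar sums, one
  for each matrix entry.\<close>

lemma norm_linear_le_entries:
  fixes T :: "'a::euclidean_space \<Rightarrow> 'b::euclidean_space" and b :: real
  assumes T: "linear T" and b: "\<And>i j. i \<in> Basis \<Longrightarrow> j \<in> Basis \<Longrightarrow> \<bar>T i \<bullet> j\<bar> \<le> b"
  shows "norm (T u) \<le> DIM('b) * (DIM('a) * b) * norm u"
proof -
  have "\<bar>T u \<bullet> j\<bar> \<le> DIM('a) * b * norm u" if j: "j \<in> Basis" for j
  proof -
    have "T u = T (\<Sum>i\<in>Basis. (u \<bullet> i) *\<^sub>R i)" by (simp add: euclidean_representation)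
    also have "\<dots> = (\<Sum>i\<in>Basis. (u \<bullet> i) *\<^sub>R T i)"
      by (simp add: linear_sum[OF T] linear_scale[OF T])
    finally have "\<bar>T u \<bullet> j\<bar> = \<bar>\<Sum>i\<in>Basis. (u \<bullet> i) * (T i \<bullet> j)\<bar>"
      by (simp add: inner_sum_left)
    also have "\<dots> \<le> (\<Sum>i\<in>Basis. \<bar>u \<bullet> i\<bar> * \<bar>T i \<bullet> j\<bar>)"
      by (rule order_trans[OF sum_abs]) (simp add: abs_mult)
    also have "\<dots> \<le> (\<Sum>i\<in>(Basis::'a set). norm u * b)"
      using b j by (intro sum_mono mult_mono Basis_le_norm) auto
    finally show ?thesis by (simp add: mult_ac)
  qed
  then have "(\<Sum>j\<in>Basis. \<bar>T u \<bullet> j\<bar>) \<le> (\<Sum>j\<in>(Basis::'b set). DIM('a) * b * norm u)"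
    by (intro sum_mono) auto
  then show ?thesis using norm_le_l1[of "T u"] by (simp add: mult_ac)
qed

lemma linear_sub_scaled_matrix:
  assumes "\<And>v. v \<in> I \<Longrightarrow> linear (f v)"
  shows "linear (\<lambda>u. (\<Sum>v\<in>I. f v u) - k *\<^sub>R ((H::real^'d^'e) *v u))"
  by (rule linearI)
    (simp_all add: linear_add[OF assms] linear_scale[OF assms] sum.distrib matrix_vector_right_distrib
      matrix_vector_mult_scaleR scaleR_sum_right algebra_simps)

context skewed_setting
begin

lemma asymp_strategyproof_skewed_gm:
  assumes S: "pos_def_matrix S"
  shows "asymp_strategyproof (Skew (matrix_inv S ** limit_hessian \<Sigma> D ** matrix_inv S)) \<Sigma> S D"
  unfolding asymp_strategyproof_def
proof (intro allI impI)
  fix \<epsilon> \<delta> :: real assume \<epsilon>: "\<epsilon> > 0" and \<delta>: "\<delta> > 0"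
  define g where "g = limit_gm \<Sigma> D"
  define H where "H = limit_hessian \<Sigma> D"
  define \<alpha> where "\<alpha> = Skew (matrix_inv S ** H ** matrix_inv S)"
  have g: "g \<in> \<Theta>" unfolding g_def by (rule limit_gm_mem)
  have H: "pos_def_matrix H" and Hv: "H *v v = mean_hess g v" for v
    unfolding H_def limit_hessian_def g_def[symmetric]
    using pos_def_hessian[OF g] hessian_limit_loss[OF g] by auto
  have \<alpha>: "0 \<le> \<alpha>" unfolding \<alpha>_def by (intro Skew_nonneg pos_def_conjugate H S)
  obtain C where C: "C > 0" "\<And>x. norm (\<Sigma> *v x) \<le> C * norm x"
    using matrix_vector_norm_bound[of \<Sigma>] by blast
  obtain c where c: "c > 0" "\<And>x. c * norm x \<le> norm (\<Sigma> *v x)"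
    using pos_def_norm_bound[OF \<Sigma>] by blast
  obtain M where M: "M > 0" "\<And>x. norm (S *v x) \<le> M * norm x"
    using matrix_vector_norm_bound[of S] by blast
  obtain l where l: "l > 0" "\<And>x. l * norm x \<le> norm (S *v x)"
    using pos_def_norm_bound[OF S] by blast
  define L where "L = 1 / l"
  have L: "L > 0" "\<And>x. norm x \<le> L * norm (S *v x)"
    using l by (auto simp: L_def pos_le_divide_eq mult.commute)
  obtain \<kappa> where \<kappa>: "\<kappa> > 0" "\<And>x. \<kappa> * (norm x)\<^sup>2 \<le> x \<bullet> (H *v x)"
    using pos_def_quadratic_bound[OF H] by blast
  have "isCont p g"
    using p_C1 g has_derivative_continuous
    unfolding cont_differentiable_on_def gderiv_def by blast
  then obtain K where K: "\<And>r. 0 < r \<Longrightarrow> measure D (cball g r) \<le> K * r ^ 5"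
    using density_small_ball[of D p g] dim prob density p_meas by auto
  \<comment> \<open>The slack \<epsilon> as a relative loss: the core lemma may lose a factor
    \<open>1 - q\<close> on its left side, and \<eta> is then chosen so small that it loses no
    more.\<close>
  define q where "q = \<epsilon> / (1 + \<alpha> + \<epsilon>)"
  have q: "0 < q" "q < 1" "1 + \<alpha> = (1 + \<alpha> + \<epsilon>) * (1 - q)"
    using \<alpha> \<epsilon> by (auto simp: q_def field_simps)
  define \<eta> where "\<eta> = min (\<kappa> / 2) (q * \<kappa> / (1 + L * M))"
  have LM: "0 < 1 + L * M" using L(1) M(1) by (simp add: add_pos_pos)
  have \<eta>: "0 < \<eta>" "\<eta> \<le> \<kappa> / 2" "\<eta> * (1 + L * M) / \<kappa> \<le> q"
  proof -
    show "0 < \<eta>" using \<kappa>(1) q(1) LM by (simp add: \<eta>_def)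
    show "\<eta> \<le> \<kappa> / 2" unfolding \<eta>_def by (rule min.cobounded1)
    have "\<eta> \<le> q * \<kappa> / (1 + L * M)" by (simp add: \<eta>_def)
    then show "\<eta> * (1 + L * M) / \<kappa> \<le> q" using \<kappa>(1) LM by (simp add: pos_le_divide_eq pos_divide_le_eq)
  qed
  define n where "n = real CARD('d)"
  have n: "n > 0" by (simp add: n_def)
  \<comment> \<open>Half of \<eta> goes to the remainders and half to the Hessian. The n * n entries
    of size \<open>c3\<close> add up to \<eta>2, and the n gradient coordinates use half of the
    allowance V \<kappa> r / 8, leaving the other half for \<open>C\<close>.\<close>
  define \<eta>1 \<eta>2 c3 c4 where "\<eta>1 = \<eta> / (80 * C ^ 3)" and "\<eta>2 = \<eta> / 2" and "c3 = \<eta>2 / (n * n)"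
    and "c4 = \<kappa> / (16 * n)"
  have pos: "\<eta>1 > 0" "c3 > 0" "c4 > 0" using \<eta>(1) C(1) \<kappa>(1) n by (auto simp: \<eta>1_def \<eta>2_def c3_def c4_def)
  have \<eta>12: "\<eta> = 40 * C ^ 3 * \<eta>1 + \<eta>2" using C(1) by (simp add: \<eta>1_def \<eta>2_def)
  define r where "r V = real V powr (-1/4)" for V :: nat
  define P where "P V = Pi\<^sub>M {1..V} (\<lambda>_. D)" for V :: nat
  interpret P: prob_space "P V" for V unfolding P_def by (rule prob_space_PiM) (rule prob)
  let ?h = "\<lambda>i j \<theta>. mnorm_hess \<Sigma> (g - \<theta>) i \<bullet> j"
  let ?G = "\<lambda>j \<theta>. mnorm_grad \<Sigma> (g - \<theta>) \<bullet> j"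
  \<comment> \<open>The bad events: a voter too close to \<open>g\<close>, a large sum of inverse
    squares, and an atypical entry of the Hessian or of the gradient. The last two share the
    threshold V r; the gradient needs that precision, while for the Hessian only r \<le> 1 is used
    later.\<close>
  define B1 where "B1 V = {\<omega> \<in> space (P V). \<exists>v\<in>{1..V}. \<omega> v \<in> cball g (2 * C * r V / c)}" for V
  define B2 where "B2 V = {\<omega> \<in> space (P V).
    \<eta>1 * real V \<le> r V * (\<Sum>v=1..V. 1 / (norm (\<Sigma> *v (g - \<omega> v)))\<^sup>2)}" for V
  define B3 where "B3 V i j = {\<omega> \<in> space (P V).
    c3 * (real V * r V) \<le> \<bar>(\<Sum>v=1..V. ?h i j (\<omega> v)) - V * (LINT \<theta>|D. ?h i j \<theta>)\<bar>}" for V i j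
  define B4 where "B4 V j = {\<omega> \<in> space (P V).
    c4 * (real V * r V) \<le> \<bar>(\<Sum>v=1..V. ?G j (\<omega> v)) - V * (LINT \<theta>|D. ?G j \<theta>)\<bar>}" for V j
  have lim1: "(\<lambda>V. P.prob V (B1 V)) \<longlonglongrightarrow> 0"
  proof (rule tendsto_sandwich[OF _ _ tendsto_const])
    \<comment> \<open>The fifth power pays for the union bound: the expression is of order V *
      V^(-5/4).\<close>
    show "(\<lambda>V. real V * (K * (2 * C * r V / c) ^ 5)) \<longlonglongrightarrow> 0"
      unfolding r_def using C(1) c(1) by real_asymp
    show "\<forall>\<^sub>F V in sequentially. P.prob V (B1 V) \<le> real V * (K * (2 * C * r V / c) ^ 5)"
      using eventually_gt_at_top[of 0]
    proof eventually_elim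
      case (elim V)
      have "P.prob V (B1 V) \<le> real V * measure D (cball g (2 * C * r V / c))"
        unfolding B1_def P_def by (rule prob_some_component_le[OF prob]) simp
      also have "\<dots> \<le> real V * (K * (2 * C * r V / c) ^ 5)"
        using elim C(1) c(1) by (intro mult_left_mono K) (auto simp: r_def)
      finally show ?case .
    qed
  qed simp
  have lim2: "(\<lambda>V. P.prob V (B2 V)) \<longlonglongrightarrow> 0"
    unfolding B2_def P_def r_def
    by (rule prob_sum_Markov_tendsto_0[OF prob integrable_inverse_square[OF g] _ pos(1)]) simp
  have lim3: "(\<lambda>V. P.prob V (B3 V i j)) \<longlonglongrightarrow> 0" for i j
    unfolding B3_def P_def r_def
    by (rule prob_sum_deviation_tendsto_0[OF prob _ integrable_mnorm_hess_square[OF g] pos(2)]) measurable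
  have lim4: "(\<lambda>V. P.prob V (B4 V j)) \<longlonglongrightarrow> 0" for j
    unfolding B4_def P_def r_def
  proof (rule prob_sum_deviation_tendsto_0[OF prob _ _ pos(3)])
    have "\<bar>?G j \<theta>\<bar> \<le> C * norm j" for \<theta>
    proof -
      have "\<bar>?G j \<theta>\<bar> \<le> norm (mnorm_grad \<Sigma> (g - \<theta>)) * norm j" by (rule Cauchy_Schwarz_ineq2)
      also have "\<dots> \<le> C * norm j" using C by (intro mult_right_mono norm_mnorm_grad_le) auto
      finally show ?thesis .
    qed
    then have "(?G j \<theta>)\<^sup>2 \<le> (C * norm j)\<^sup>2" for \<theta>
      by (metis abs_ge_zero power2_abs power_mono)
    then show "integrable D (\<lambda>\<theta>. (?G j \<theta>)\<^sup>2)"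
      by (intro integrable_const_bound[of _ "(C * norm j)\<^sup>2"]) auto
  qed measurable
  define Bad where "Bad V = (B1 V \<union> B2 V) \<union> ((\<Union>ij\<in>Basis \<times> Basis. B3 V (fst ij) (snd ij)) \<union> (\<Union>j\<in>Basis. B4 V j))" for V
  have comp: "(\<lambda>\<omega>. \<omega> v) \<in> P V \<rightarrow>\<^sub>M borel" if "v \<in> {1..V}" for v V
    using measurable_component_singleton[OF that, of "\<lambda>_. D"] unfolding P_def
    by (simp cong: measurable_cong_sets)
  have meas: "(\<lambda>\<omega>. \<Sum>v=1..V. f (\<omega> v)) \<in> borel_measurable (P V)" if "f \<in> borel_measurable borel"
    for f :: "real^'d \<Rightarrow> real" and V
    by (intro borel_measurable_sum measurable_compose[OF comp that])
  have s1: "B1 V \<in> sets (P V)" for V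
  proof -
    have "B1 V = (\<Union>v\<in>{1..V}. (\<lambda>\<omega>. \<omega> v) -` cball g (2 * C * r V / c) \<inter> space (P V))"
      by (auto simp: B1_def)
    also have "\<dots> \<in> sets (P V)"
      by (intro sets.finite_UN measurable_sets[OF comp]) auto
    finally show ?thesis .
  qed
  have s2: "B2 V \<in> sets (P V)" for V
    unfolding B2_def
    by (intro borel_measurable_le borel_measurable_times borel_measurable_const meas) measurable
  have s3: "B3 V i j \<in> sets (P V)" for V i j
    unfolding B3_def
    by (intro borel_measurable_le borel_measurable_abs borel_measurable_diff borel_measurable_const meas) measurable
  have s4: "B4 V j \<in> sets (P V)" for V j
    unfolding B4_def
    by (intro borel_measurable_le borel_measurable_abs borel_measurable_diff borel_measurable_const meas) measurable
  have sBad: "Bad V \<in> sets (P V)" for V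
    unfolding Bad_def using s1 s2 s3 s4 by (intro sets.Un sets.finite_UN) auto
  define f where "f V = (P.prob V (B1 V) + P.prob V (B2 V))
    + ((\<Sum>ij\<in>Basis \<times> Basis. P.prob V (B3 V (fst ij) (snd ij))) + (\<Sum>j\<in>Basis. P.prob V (B4 V j)))" for V
  have Bad_le: "P.prob V (Bad V) \<le> f V" for V
    unfolding Bad_def f_def
    by (intro order_trans[OF measure_Un_le] add_mono order_refl measure_UNION_le sets.Un sets.finite_UN)
      (use s1 s2 s3 s4 in auto)
  have "f \<longlonglongrightarrow> (0 + 0) + ((\<Sum>ij\<in>(Basis::(real^'d) set) \<times> (Basis::(real^'d) set). 0) + (\<Sum>j\<in>(Basis::(real^'d) set). 0))"
    unfolding f_def by (intro tendsto_intros lim1 lim2 lim3 lim4)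
  then have "f \<longlonglongrightarrow> 0" by simp
  then have ev1: "\<forall>\<^sub>F V in sequentially. f V < \<delta>" by (rule order_tendstoD(2)) (rule \<delta>)
  \<comment> \<open>The pull of all voters at distance r is of order V^(3/4) and eventually
    outweighs a single vote, whose gradient is at most \<open>C\<close>.\<close>
  have ev2: "\<forall>\<^sub>F V in sequentially. C < V * \<kappa> * r V / 16"
    unfolding r_def using \<kappa>(1) by real_asymp
  have "\<forall>\<^sub>F V in sequentially. 1 \<le> V \<and> f V < \<delta> \<and> C < V * \<kappa> * r V / 16"
    using ev1 ev2 eventually_ge_at_top[of 1] by eventually_elim simp
  then obtain V0 where V0: "\<And>V. V \<ge> V0 \<Longrightarrow> 1 \<le> V \<and> f V < \<delta> \<and> C < V * \<kappa> * r V / 16"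
    unfolding eventually_sequentially by blast
  show "\<exists>V0\<ge>1. \<forall>V\<ge>V0. with_prob_at_least (Pi\<^sub>M {1..V} (\<lambda>_. D)) (1 - \<delta>)
      (\<lambda>\<theta>. \<forall>t s gt gs. is_skewed_gm \<Sigma> t V \<theta> gt \<longrightarrow> is_skewed_gm \<Sigma> s V \<theta> gs \<longrightarrow>
         mnorm S (gt - t) \<le> (1 + Skew (matrix_inv S ** limit_hessian \<Sigma> D ** matrix_inv S) + \<epsilon>) * mnorm S (gs - t))"
    unfolding with_prob_at_least_def P_def[symmetric] H_def[symmetric] \<alpha>_def[symmetric]
  proof (intro exI[of _ "max 1 V0"] conjI allI impI)
    fix V assume "max 1 V0 \<le> V"
    then have V: "1 \<le> V" "f V < \<delta>" "C < V * \<kappa> * r V / 16" using V0[of V] by auto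
    have r: "0 < r V" "r V \<le> 1" using V(1) powr_mono[of "-1/4" 0 "real V"] by (auto simp: r_def)
    show "\<exists>A\<in>sets (P V). (\<forall>\<theta>\<in>A. \<forall>t s gt gs. is_skewed_gm \<Sigma> t V \<theta> gt \<longrightarrow> is_skewed_gm \<Sigma> s V \<theta> gs \<longrightarrow>
         mnorm S (gt - t) \<le> (1 + \<alpha> + \<epsilon>) * mnorm S (gs - t)) \<and> 1 - \<delta> \<le> P.prob V A"
    proof (intro bexI[of _ "space (P V) - Bad V"] conjI ballI allI impI)
      show "space (P V) - Bad V \<in> sets (P V)" using sBad by auto
      show "1 - \<delta> \<le> P.prob V (space (P V) - Bad V)"
        using P.prob_compl[OF sBad[of V]] Bad_le[of V] V(2) by simp
      fix \<theta> t s gt gs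
      assume \<theta>: "\<theta> \<in> space (P V) - Bad V" and gt: "is_skewed_gm \<Sigma> t V \<theta> gt" and gs: "is_skewed_gm \<Sigma> s V \<theta> gs"
      have n1: "\<theta> \<notin> B1 V" and n2: "\<theta> \<notin> B2 V"
        and n3: "\<And>i j. i \<in> Basis \<Longrightarrow> j \<in> Basis \<Longrightarrow> \<theta> \<notin> B3 V i j"
        and n4: "\<And>j. j \<in> Basis \<Longrightarrow> \<theta> \<notin> B4 V j"
        using \<theta> unfolding Bad_def by auto
      have sep: "2 * C * r V < norm (\<Sigma> *v (g - \<theta> v))" if "v \<in> {1..V}" for v
      proof -
        have "2 * C * r V / c < norm (g - \<theta> v)" using n1 \<theta> that by (force simp: B1_def dist_norm)
        then have "2 * C * r V < c * norm (g - \<theta> v)" using c(1) by (simp add: pos_divide_less_eq mult.commute)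
        also have "\<dots> \<le> norm (\<Sigma> *v (g - \<theta> v))" by (rule c)
        finally show ?thesis .
      qed
      have inv: "r V * (\<Sum>v=1..V. 1 / (norm (\<Sigma> *v (g - \<theta> v)))\<^sup>2) \<le> V * \<eta>1"
        using n2 \<theta> by (auto simp: B2_def mult.commute)
      have hess: "norm ((\<Sum>v=1..V. mnorm_hess \<Sigma> (g - \<theta> v) u) - real V *\<^sub>R (H *v u)) \<le> V * \<eta>2 * norm u" for u
      proof -
        let ?T = "\<lambda>u. (\<Sum>v=1..V. mnorm_hess \<Sigma> (g - \<theta> v) u) - real V *\<^sub>R (H *v u)"
        have "norm (?T u) \<le> DIM(real^'d) * (DIM(real^'d) * (c3 * V)) * norm u"
        proof (rule norm_linear_le_entries[where T = ?T])
          show "linear ?T" by (rule linear_sub_scaled_matrix) (rule linear_mnorm_hess)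
          fix i j :: "real^'d" assume ij: "i \<in> Basis" "j \<in> Basis"
          have "(LINT x|D. ?h i j x) = (H *v i) \<bullet> j"
            unfolding Hv mean_hess_def using integrable_mnorm_hess[OF g] by simp
          then have "\<bar>?T i \<bullet> j\<bar> < c3 * (real V * r V)"
            using n3[OF ij] \<theta> by (simp add: B3_def inner_diff_left inner_sum_left)
          also have "\<dots> \<le> c3 * (real V * 1)" using r pos by (intro mult_left_mono) auto
          finally show "\<bar>?T i \<bullet> j\<bar> \<le> c3 * V" by simp
        qed
        also have "\<dots> = V * \<eta>2 * norm u" using n by (simp add: c3_def n_def[symmetric])
        finally show ?thesis .
      qed
      have grad: "norm (grad_sum \<Sigma> V \<theta> g) + C < V * \<kappa> * r V / 8"
      proof -
        have "norm (grad_sum \<Sigma> V \<theta> g) \<le> (\<Sum>j\<in>Basis. \<bar>grad_sum \<Sigma> V \<theta> g \<bullet> j\<bar>)" by (rule norm_le_l1)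
        also have "\<dots> \<le> (\<Sum>j\<in>(Basis::(real^'d) set). c4 * (V * r V))"
        proof (rule sum_mono)
          fix j :: "real^'d" assume j: "j \<in> Basis"
          \<comment> \<open>The mean vanishes at the limit median, so the whole empirical gradient
            there is fluctuation and falls under the threshold.\<close>
          have "(LINT x|D. ?G j x) = mean_grad g \<bullet> j"
            unfolding mean_grad_def using integrable_mnorm_grad by simp
          then have "(LINT x|D. ?G j x) = 0" using mean_grad_limit_gm by (simp add: g_def)
          then show "\<bar>grad_sum \<Sigma> V \<theta> g \<bullet> j\<bar> \<le> c4 * (V * r V)"
            using n4[OF j] \<theta> by (simp add: B4_def grad_sum_def inner_sum_left)
        qed
        also have "\<dots> = V * \<kappa> * r V / 16" using n by (simp add: c4_def n_def[symmetric])
        finally show ?thesis using V(3) by simp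
      qed
      have "(1 - q) * mnorm S (gt - t) \<le> (1 - \<eta> * (1 + L * M) / \<kappa>) * mnorm S (gt - t)"
        using \<eta>(3) by (intro mult_right_mono) (auto simp: mnorm_def)
      also have "\<dots> \<le> (1 + \<alpha>) * mnorm S (gs - t)"
        unfolding \<alpha>_def
        by (rule skewed_gm_near_strategyproof[OF \<Sigma> S H C \<kappa> L M r(1) sep inv hess \<eta>12 _ \<eta>(2) grad gt gs])
          (use \<eta>(1) in auto)
      also have "\<dots> = (1 - q) * ((1 + \<alpha> + \<epsilon>) * mnorm S (gs - t))"
        by (subst q(3)) (simp only: mult_ac)
      finally show "mnorm S (gt - t) \<le> (1 + \<alpha> + \<epsilon>) * mnorm S (gs - t)"
        using q(2) by simp
    qed
  qed simp
qed

end

lemma Skew_mat_1: "Skew (mat 1 :: real^'d^'d) = 0"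
proof -
  have "(\<lambda>x::real^'d. norm x * norm x / (x \<bullet> x) - 1) ` {x. x \<noteq> 0} = {0}"
  proof -
    have "norm x * norm x / (x \<bullet> x) - 1 = 0" if "x \<noteq> 0" for x :: "real^'d"
      using that by (simp add: dot_square_norm power2_eq_square)
    moreover have "{x::real^'d. x \<noteq> 0} \<noteq> {}"
      using vector_choose_size[of 1]
      by (metis (mono_tags) mem_Collect_eq empty_iff norm_zero zero_le_one zero_neq_one)
    ultimately show ?thesis by (auto simp: image_constant_conv)
  qed
  then show ?thesis unfolding Skew_def by simp
qed

theorem theorem3:
  fixes D :: "(real^'d) measure" and p :: "real^'d \<Rightarrow> real" and \<Theta> :: "(real^'d) set"
    and \<Sigma> S :: "real^'d^'d"
  assumes dim: "CARD('d) \<ge> 5"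
    and prob: "prob_space D"
    and \<Theta>: "open \<Theta>" "convex \<Theta>"
    and p_meas: "p \<in> borel_measurable borel"
    and p_nonneg: "\<And>x. p x \<ge> 0"
    and density: "D = density lborel (\<lambda>x. ennreal (p x))"
    and p_C1: "cont_differentiable_on p \<Theta>"
    and supp: "measure D \<Theta> = 1"
    and moment: "integrable D (\<lambda>\<theta>. norm \<theta>)"
    and \<Sigma>: "pos_def_matrix \<Sigma>"
    and S: "pos_def_matrix S"
  shows "asymp_strategyproof
           (Skew (matrix_inv S ** limit_hessian \<Sigma> D ** matrix_inv S)) \<Sigma> S D \<and>
         (limit_hessian \<Sigma> D = S ** S \<longrightarrow> asymp_strategyproof 0 \<Sigma> S D)"
proof -
  interpret prob_space D by (rule prob)
  interpret skewed_setting D p \<Theta> \<Sigma>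
    using assms by unfold_locales
  have 1: "asymp_strategyproof (Skew (matrix_inv S ** limit_hessian \<Sigma> D ** matrix_inv S)) \<Sigma> S D"
    by (rule asymp_strategyproof_skewed_gm[OF S])
  have "matrix_inv S ** (S ** S) ** matrix_inv S = mat 1"
    by (metis pos_def_matrix_inv(1,2)[OF S] matrix_mul_assoc matrix_mul_lid)
  with 1 show ?thesis by (auto simp: Skew_mat_1)
qed

end
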